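(* Let $\Omega\subset\mathbb{R}^N$, $1\le N\le 3$, be a bounded domain with smooth boundary. Let $\alpha\in C^1(\mathbb{R};\mathbb{R})$ with $\alpha(0)=0$ and $\alpha'(r)\ge\sigma>0$ for all $r\in\mathbb{R}$. Let $\lambda\ge 0$, let $I\subset\mathbb{R}$ be an open (bounded or unbounded) interval with $0\in I$, and let $W\in C^{1,1}_{\rm loc}(I;\mathbb{R})$ satisfy $W'(0)=0$, $W''\ge-\lambda$ a.e. in $I$, $\lim_{r\to\partial I}W'(r)\,\mathrm{sign}\,r=+\infty$, and $W(r)\ge \eta r^2/2$ for all $r\in I$ and some $\eta>0$. Let $f\in L^\infty(\Omega)$. Let $u,v$ be $\mathcal{X}_2$-solutions of Problem (P) corresponding respectively to initial data $u_0,v_0\in\mathcal{X}_2$. Assume that, for some $s,c\ge0$, $$u(s)=v(s),\qquad d_\infty(u(t),0)+d_\infty(v(t),0)\le c\quad\forall\,t\ge s,$$ with $c$ independent of $t$. Then $u\equiv v$ on $[s,\infty)$.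
   Context: Notation: $H=L^2(\Omega)$ with norm $\|\cdot\|$ and scalar product $(\cdot,\cdot)$; $V=H^1_0(\Omega)$, $V'=H^{-1}(\Omega)$; $B:V\to V'$ is given by $\langle Bu,v\rangle=(\nabla u,\nabla v)$ (Dirichlet Laplacian). $\mathcal{X}_2:=\{u\in H: Bu,\,W'(u)\in H\}$ (so $u\in V$ and $u\in I$ a.e.), with metric $d_2^2(u,v)=\|u-v\|^2+\|Bu-Bv\|^2+\|(W'(u)+\lambda u)-(W'(v)+\lambda v)\|^2$. $\mathcal{X}_\infty:=\{u\in L^\infty(\Omega): Bu,\,W'(u)\in L^\infty(\Omega)\}$, with metric $d_\infty^2(u,v)=\|u-v\|_{L^\infty}^2+\|Bu-Bv\|_{L^\infty}^2+\|(W'(u)+\lambda u)-(W'(v)+\lambda v)\|_{L^\infty}^2$. Problem (P) with initial datum $u_0$: $\alpha(u_t)+Bu+W'(u)=f$ in $H$, a.e. in $(0,\infty)$; $u|_{t=0}=u_0$ in $H$. $\mathcal{X}_2$-solution of (P): a function $u:[0,\infty)\to H$ satisfying (P), with $u,u_t,\alpha(u_t),Bu,W'(u)\in L^\infty(0,\infty;H)$ and, for some $C>0$, $d_2^2(u(t),0)\le C^2$ for all $t\in[0,\infty)$. *)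

theory Defs
  imports "HOL-Probability.Essential_Supremum" "HOL-Analysis.Analysis"
begin

section \<open>Smooth functions, test functions, smooth domains\<close>

primrec Ck :: "nat \<Rightarrow> ('a::euclidean_space \<Rightarrow> real) \<Rightarrow> bool" where
  "Ck 0 f \<longleftrightarrow> continuous_on UNIV f"
| "Ck (Suc k) f \<longleftrightarrow>
     f differentiable_on UNIV \<and> (\<forall>b\<in>Basis. Ck k (\<lambda>x. frechet_derivative f (at x) b))"

definition smooth :: "('a::euclidean_space \<Rightarrow> real) \<Rightarrow> bool" where
  "smooth f \<longleftrightarrow> (\<forall>k. Ck k f)"

definition test_function :: "'a::euclidean_space set \<Rightarrow> ('a \<Rightarrow> real) \<Rightarrow> bool" where
  "test_function \<Omega> \<phi> \<longleftrightarrow>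
     smooth \<phi> \<and> compact (closure {x. \<phi> x \<noteq> 0}) \<and> closure {x. \<phi> x \<noteq> 0} \<subseteq> \<Omega>"

text \<open>Near each boundary point, and in a suitable direction \<open>e\<close>, the domain is the strict
  epigraph of a smooth function \<open>\<gamma>\<close> of the variables orthogonal to \<open>e\<close>
  (\<open>\<gamma>\<close> is only evaluated on the hyperplane orthogonal to \<open>e\<close>).\<close>

definition smooth_boundary :: "'a::euclidean_space set \<Rightarrow> bool" where
  "smooth_boundary \<Omega> \<longleftrightarrow>
     (\<forall>x0\<in>frontier \<Omega>. \<exists>r>0. \<exists>e \<gamma>. norm e = 1 \<and> smooth \<gamma> \<and>
        \<Omega> \<inter> ball x0 r = {x \<in> ball x0 r. \<gamma> (x - (x \<bullet> e) *\<^sub>R e) < x \<bullet> e})"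

definition smooth_bounded_domain :: "'a::euclidean_space set \<Rightarrow> bool" where
  "smooth_bounded_domain \<Omega> \<longleftrightarrow>
     open \<Omega> \<and> connected \<Omega> \<and> \<Omega> \<noteq> {} \<and> bounded \<Omega> \<and> smooth_boundary \<Omega>"


section \<open>Lebesgue spaces on a domain\<close>

text \<open>Elements of Lebesgue and Sobolev spaces are represented by functions; all notions below
  depend on them only through their values almost everywhere in \<open>\<Omega>\<close>, and equality in
  such a space is equality almost everywhere in \<open>\<Omega>\<close>.\<close>

definition L2 :: "'a::euclidean_space set \<Rightarrow> ('a \<Rightarrow> real) set" where
  "L2 \<Omega> = {u. u \<in> borel_measurable (lebesgue_on \<Omega>) \<and>
              integrable (lebesgue_on \<Omega>) (\<lambda>x. (u x)\<^sup>2)}"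

definition L2_inner :: "'a::euclidean_space set \<Rightarrow> ('a \<Rightarrow> real) \<Rightarrow> ('a \<Rightarrow> real) \<Rightarrow> real" where
  "L2_inner \<Omega> u v = (LINT x|lebesgue_on \<Omega>. u x * v x)"

definition L2_norm :: "'a::euclidean_space set \<Rightarrow> ('a \<Rightarrow> real) \<Rightarrow> real" where
  "L2_norm \<Omega> u = sqrt (L2_inner \<Omega> u u)"

definition Linf :: "'a::euclidean_space set \<Rightarrow> ('a \<Rightarrow> real) set" where
  "Linf \<Omega> = {u. u \<in> borel_measurable (lebesgue_on \<Omega>) \<and>
                esssup (lebesgue_on \<Omega>) (\<lambda>x. ereal \<bar>u x\<bar>) < \<infinity>}"

definition Linf_norm :: "'a::euclidean_space set \<Rightarrow> ('a \<Rightarrow> real) \<Rightarrow> real" where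
  "Linf_norm \<Omega> u = real_of_ereal (esssup (lebesgue_on \<Omega>) (\<lambda>x. ereal \<bar>u x\<bar>))"


section \<open>Sobolev spaces and the Dirichlet Laplacian\<close>

definition is_weak_grad :: "'a::euclidean_space set \<Rightarrow> ('a \<Rightarrow> real) \<Rightarrow> ('a \<Rightarrow> 'a) \<Rightarrow> bool" where
  "is_weak_grad \<Omega> u G \<longleftrightarrow>
     G \<in> borel_measurable (lebesgue_on \<Omega>) \<and>
     integrable (lebesgue_on \<Omega>) (\<lambda>x. (norm (G x))\<^sup>2) \<and>
     (\<forall>\<phi>. test_function \<Omega> \<phi> \<longrightarrow> (\<forall>b\<in>Basis.
        (LINT x|lebesgue_on \<Omega>. u x * frechet_derivative \<phi> (at x) b)
          = - (LINT x|lebesgue_on \<Omega>. (G x \<bullet> b) * \<phi> x)))"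

definition H1 :: "'a::euclidean_space set \<Rightarrow> ('a \<Rightarrow> real) set" where
  "H1 \<Omega> = {u \<in> L2 \<Omega>. \<exists>G. is_weak_grad \<Omega> u G}"

text \<open>The weak gradient is unique almost everywhere, so the choice is immaterial.\<close>

definition weak_grad :: "'a::euclidean_space set \<Rightarrow> ('a \<Rightarrow> real) \<Rightarrow> 'a \<Rightarrow> 'a" where
  "weak_grad \<Omega> u = (SOME G. is_weak_grad \<Omega> u G)"

definition H1_norm :: "'a::euclidean_space set \<Rightarrow> ('a \<Rightarrow> real) \<Rightarrow> real" where
  "H1_norm \<Omega> u =
     sqrt ((L2_norm \<Omega> u)\<^sup>2 + (LINT x|lebesgue_on \<Omega>. (norm (weak_grad \<Omega> u x))\<^sup>2))"

definition H10 :: "'a::euclidean_space set \<Rightarrow> ('a \<Rightarrow> real) set" where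
  "H10 \<Omega> = {u \<in> H1 \<Omega>. \<exists>\<phi>::nat \<Rightarrow> 'a \<Rightarrow> real.
     (\<forall>n. test_function \<Omega> (\<phi> n)) \<and> (\<lambda>n. H1_norm \<Omega> (\<lambda>x. \<phi> n x - u x)) \<longlonglongrightarrow> 0}"

text \<open>The duality pairing \<open>\<langle>Bu, v\<rangle>\<close> for \<open>u\<close>, \<open>v\<close> in \<open>H10 \<Omega>\<close>.\<close>

definition B_pairing :: "'a::euclidean_space set \<Rightarrow> ('a \<Rightarrow> real) \<Rightarrow> ('a \<Rightarrow> real) \<Rightarrow> real" where
  "B_pairing \<Omega> u v = (LINT x|lebesgue_on \<Omega>. weak_grad \<Omega> u x \<bullet> weak_grad \<Omega> v x)"

text \<open>\<open>u \<in> V\<close> and the functional \<open>Bu \<in> V'\<close> is represented by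
  \<open>g \<in> H\<close> under the usual embedding of \<open>H\<close> into \<open>V'\<close>.\<close>

definition B_represented_by ::
    "'a::euclidean_space set \<Rightarrow> ('a \<Rightarrow> real) \<Rightarrow> ('a \<Rightarrow> real) \<Rightarrow> bool" where
  "B_represented_by \<Omega> u g \<longleftrightarrow>
     u \<in> H10 \<Omega> \<and> g \<in> L2 \<Omega> \<and> (\<forall>v\<in>H10 \<Omega>. B_pairing \<Omega> u v = L2_inner \<Omega> g v)"

text \<open>The (almost everywhere unique) function representing \<open>Bu\<close>, meaningful when
  \<open>Bu \<in> H\<close>.\<close>

definition B_op :: "'a::euclidean_space set \<Rightarrow> ('a \<Rightarrow> real) \<Rightarrow> 'a \<Rightarrow> real" where
  "B_op \<Omega> u = (SOME g. B_represented_by \<Omega> u g)"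


section \<open>The phase spaces\<close>

text \<open>Since \<open>W\<close> only matters on \<open>I\<close>, membership of \<open>W'(u)\<close> in a function
  space includes \<open>u \<in> I\<close> almost everywhere.\<close>

definition X2 :: "'a::euclidean_space set \<Rightarrow> real set \<Rightarrow> (real \<Rightarrow> real) \<Rightarrow> ('a \<Rightarrow> real) set" where
  "X2 \<Omega> I W = {u \<in> L2 \<Omega>. (\<exists>g. B_represented_by \<Omega> u g) \<and>
     (AE x in lebesgue_on \<Omega>. u x \<in> I) \<and> (\<lambda>x. deriv W (u x)) \<in> L2 \<Omega>}"

definition d2 :: "'a::euclidean_space set \<Rightarrow> (real \<Rightarrow> real) \<Rightarrow> real
    \<Rightarrow> ('a \<Rightarrow> real) \<Rightarrow> ('a \<Rightarrow> real) \<Rightarrow> real" where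
  "d2 \<Omega> W lam u v = sqrt (
     (L2_norm \<Omega> (\<lambda>x. u x - v x))\<^sup>2 +
     (L2_norm \<Omega> (\<lambda>x. B_op \<Omega> u x - B_op \<Omega> v x))\<^sup>2 +
     (L2_norm \<Omega> (\<lambda>x. (deriv W (u x) + lam * u x) - (deriv W (v x) + lam * v x)))\<^sup>2)"

definition Xinf :: "'a::euclidean_space set \<Rightarrow> real set \<Rightarrow> (real \<Rightarrow> real) \<Rightarrow> ('a \<Rightarrow> real) set" where
  "Xinf \<Omega> I W = {u \<in> Linf \<Omega>. (\<exists>g. B_represented_by \<Omega> u g \<and> g \<in> Linf \<Omega>) \<and>
     (AE x in lebesgue_on \<Omega>. u x \<in> I) \<and> (\<lambda>x. deriv W (u x)) \<in> Linf \<Omega>}"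

definition dinf :: "'a::euclidean_space set \<Rightarrow> (real \<Rightarrow> real) \<Rightarrow> real
    \<Rightarrow> ('a \<Rightarrow> real) \<Rightarrow> ('a \<Rightarrow> real) \<Rightarrow> real" where
  "dinf \<Omega> W lam u v = sqrt (
     (Linf_norm \<Omega> (\<lambda>x. u x - v x))\<^sup>2 +
     (Linf_norm \<Omega> (\<lambda>x. B_op \<Omega> u x - B_op \<Omega> v x))\<^sup>2 +
     (Linf_norm \<Omega> (\<lambda>x. (deriv W (u x) + lam * u x) - (deriv W (v x) + lam * v x)))\<^sup>2)"


section \<open>Functions of time with values in \<open>H\<close>\<close>

text \<open>Strong (Bochner) measurability: almost everywhere limit of simple functions.\<close>

definition strongly_measurable :: "'a::euclidean_space set \<Rightarrow> (real \<Rightarrow> 'a \<Rightarrow> real) \<Rightarrow> bool" where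
  "strongly_measurable \<Omega> w \<longleftrightarrow>
     (\<exists>s::nat \<Rightarrow> real \<Rightarrow> 'a \<Rightarrow> real.
        (\<forall>n. simple_function (lebesgue_on {0<..}) (s n) \<and> (\<forall>t>0. s n t \<in> L2 \<Omega>)) \<and>
        (AE t in lebesgue_on {0<..}. (\<lambda>n. L2_norm \<Omega> (\<lambda>x. s n t x - w t x)) \<longlonglongrightarrow> 0))"

text \<open>The space \<open>L\<^sup>\<infinity>(0,\<infinity>;H)\<close>.\<close>

definition Linf_time :: "'a::euclidean_space set \<Rightarrow> (real \<Rightarrow> 'a \<Rightarrow> real) set" where
  "Linf_time \<Omega> = {w. (AE t in lebesgue_on {0<..}. w t \<in> L2 \<Omega>) \<and> strongly_measurable \<Omega> w \<and>
     (\<exists>C. AE t in lebesgue_on {0<..}. L2_norm \<Omega> (w t) \<le> C)}"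

text \<open>\<open>w = u\<^sub>t\<close> in the sense of \<open>H\<close>-valued distributions on \<open>(0,\<infinity>)\<close>: the identity
  \<open>\<integral> \<phi>' u dt = - \<integral> \<phi> w dt\<close> between Bochner integrals in \<open>H\<close>, tested against every
  element of \<open>H\<close>. Used only for \<open>u\<close> and \<open>w\<close> in \<open>Linf_time \<Omega>\<close>.\<close>

definition is_time_derivative ::
    "'a::euclidean_space set \<Rightarrow> (real \<Rightarrow> 'a \<Rightarrow> real) \<Rightarrow> (real \<Rightarrow> 'a \<Rightarrow> real) \<Rightarrow> bool" where
  "is_time_derivative \<Omega> u w \<longleftrightarrow>
     (\<forall>\<phi>. test_function {0<..} \<phi> \<longrightarrow> (\<forall>h\<in>L2 \<Omega>.
        (LINT t|lebesgue_on {0<..}. deriv \<phi> t * L2_inner \<Omega> (u t) h)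
          = - (LINT t|lebesgue_on {0<..}. \<phi> t * L2_inner \<Omega> (w t) h)))"

definition H_continuous :: "'a::euclidean_space set \<Rightarrow> (real \<Rightarrow> 'a \<Rightarrow> real) \<Rightarrow> bool" where
  "H_continuous \<Omega> u \<longleftrightarrow>
     (\<forall>t\<ge>0. ((\<lambda>\<tau>. L2_norm \<Omega> (\<lambda>x. u \<tau> x - u t x)) \<longlongrightarrow> 0) (at t within {0..}))"


section \<open>Solutions\<close>

text \<open>As \<open>u\<close> and \<open>u\<^sub>t\<close> lie in \<open>L\<^sup>\<infinity>(0,\<infinity>;H)\<close>, \<open>u\<close> has a unique representative that is
  continuous into \<open>H\<close> on \<open>[0,\<infinity>)\<close>; a solution is understood to be this representative,
  which gives meaning to its values at individual times, in particular to the initial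
  condition.\<close>

definition X2_solution :: "'a::euclidean_space set \<Rightarrow> (real \<Rightarrow> real) \<Rightarrow> real set \<Rightarrow> (real \<Rightarrow> real)
    \<Rightarrow> real \<Rightarrow> ('a \<Rightarrow> real) \<Rightarrow> ('a \<Rightarrow> real) \<Rightarrow> (real \<Rightarrow> 'a \<Rightarrow> real) \<Rightarrow> bool" where
  "X2_solution \<Omega> \<alpha> I W lam f u0 u \<longleftrightarrow>
     H_continuous \<Omega> u \<and>
     (\<exists>ut. is_time_derivative \<Omega> u ut \<and>
        u \<in> Linf_time \<Omega> \<and>
        ut \<in> Linf_time \<Omega> \<and>
        (\<lambda>t x. \<alpha> (ut t x)) \<in> Linf_time \<Omega> \<and>
        (\<lambda>t. B_op \<Omega> (u t)) \<in> Linf_time \<Omega> \<and>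
        (\<lambda>t x. deriv W (u t x)) \<in> Linf_time \<Omega> \<and>
        (AE t in lebesgue_on {0<..}. AE x in lebesgue_on \<Omega>.
           \<alpha> (ut t x) + B_op \<Omega> (u t) x + deriv W (u t x) = f x)) \<and>
     (AE x in lebesgue_on \<Omega>. u 0 x = u0 x) \<and>
     (\<forall>t\<ge>0. u t \<in> X2 \<Omega> I W) \<and>
     (\<exists>C>0. \<forall>t\<ge>0. (d2 \<Omega> W lam (u t) (\<lambda>x. 0))\<^sup>2 \<le> C\<^sup>2)"


section \<open>The potential\<close>

text \<open>\<open>W \<in> C\<^sup>1\<^sup>,\<^sup>1\<^sub>l\<^sub>o\<^sub>c(I)\<close> for an open set \<open>I\<close>.\<close>

definition C11_loc :: "real set \<Rightarrow> (real \<Rightarrow> real) \<Rightarrow> bool" where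
  "C11_loc I W \<longleftrightarrow>
     (\<forall>r\<in>I. W differentiable (at r)) \<and>
     (\<forall>K. compact K \<and> K \<subseteq> I \<longrightarrow> (\<exists>L. L-lipschitz_on K (deriv W)))"

end

theory Submission
  imports Defs
begin

text \<open>With \<open>z = u - v\<close>, \<open>F = u\<^sub>t - v\<^sub>t\<close> and \<open>b = Bu - Bv\<close>, the difference of the two equations is tested
  with \<open>F\<close>. The bound in \<open>\<X>\<^sub>\<infinity>\<close> and the blow-up of \<open>W'\<close> at the ends of \<open>I\<close> confine \<open>u\<close> and \<open>v\<close>
  to a compact subset of \<open>I\<close>, where \<open>W'\<close> is Lipschitz, so strong monotonicity of \<open>\<alpha>\<close> gives
  \<open>(b, F) \<le> - \<sigma> \<parallel>F\<parallel>\<^sup>2 + L \<parallel>z\<parallel> \<parallel>F\<parallel>\<close>. If \<open>z\<close> vanishes at time \<open>p\<close>, the chain rule for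
  \<open>\<parallel>\<nabla>z\<parallel>\<^sup>2\<close> yields \<open>0 \<le> \<integral> (b, F)\<close> over \<open>[p, q]\<close>, while \<open>\<parallel>z\<parallel> \<le> \<integral> \<parallel>F\<parallel>\<close>; together these force
  \<open>F = 0\<close> on \<open>[p, q]\<close> once \<open>L (q - p) < \<sigma>\<close>, and one proceeds in steps of fixed length.\<close>

section \<open>Smooth functions of one variable\<close>

text \<open>\<open>b\<close> is only bounded and measurable in time, so the classical chain rule for
  \<parallel>\<nabla>z\<parallel>^2 is not at hand. The energy (b t, z t) is nevertheless defined at
  every t \<ge> 0, because u t and v t lie in \<open>X2\<close> at every such time, and its backward
  differences are controlled by convexity. This gives an inequality only, which suffices: the energy
  vanishes at p and is nonnegative at q. The time derivative is distributional. To reach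
  \<parallel>z q - z p\<parallel> \<le> \<integral> \<parallel>F\<parallel>, concrete test functions
  must approximate the indicator of an interval; this is why the calculus of exp(-1/x) comes at the
  start. Identities in H are used only after pairing with a fixed element, so that all time
  integrals are real. With X = \<integral> \<parallel>F\<parallel>^2 and Y = \<integral>
  \<parallel>F\<parallel> the closing estimate is \<sigma> X \<le> L Y^2 \<le> L (q - p) X. The
  compact subset of I, hence L, is the same for all times; therefore the step length does not shrink
  on restarting.\<close>

lemma has_derivative_imp_Ck_Suc:
  fixes g g' :: "real \<Rightarrow> real"
  assumes "\<And>x. (g has_real_derivative g' x) (at x)" and "Ck k g'"
  shows "Ck (Suc k) g"
proof -
  have "frechet_derivative g (at x) = (*) (g' x)" for x
    using assms(1)[of x] frechet_derivative_at unfolding has_field_derivative_def by metis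
  moreover have "g differentiable_on UNIV"
    using assms(1) differentiable_on_def field_differentiable_imp_differentiable
      field_differentiable_def differentiable_at_withinI by metis
  ultimately show ?thesis
    using assms(2) by simp
qed

lemma Ck_Suc_imp_deriv:
  fixes g :: "real \<Rightarrow> real"
  assumes "Ck (Suc k) g"
  shows "(g has_real_derivative deriv g x) (at x)" and "Ck k (deriv g)"
proof -
  have D: "(g has_real_derivative deriv g x) (at x)" for x
    using assms by (auto simp: differentiable_on_def real_differentiable_def DERIV_deriv_iff_real_differentiable)
  show "(g has_real_derivative deriv g x) (at x)"
    by (rule D)
  have "frechet_derivative g (at x) 1 = deriv g x" for x
    using D[of x] frechet_derivative_at unfolding has_field_derivative_def by (metis mult.right_neutral)
  then show "Ck k (deriv g)"
    using assms by simp
qed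

text \<open>Needed because the product rule leaves an undifferentiated factor, given at level
  \<open>Suc k\<close> and required at level \<open>k\<close>.\<close>

lemma Ck_Suc_mono: "Ck (Suc k) g \<Longrightarrow> Ck k g" for g :: "real \<Rightarrow> real"
proof (induction k arbitrary: g)
  case 0
  then show ?case
    by (simp add: differentiable_imp_continuous_on)
next
  case (Suc k)
  then show ?case
    by (metis Ck_Suc_imp_deriv has_derivative_imp_Ck_Suc)
qed

lemma Ck_imp_continuous: "Ck k g \<Longrightarrow> continuous_on UNIV g" for g :: "real \<Rightarrow> real"
  by (induction k) (auto dest: Ck_Suc_mono simp del: Ck.simps(2))

lemma Ck_add: "Ck k f \<Longrightarrow> Ck k g \<Longrightarrow> Ck k (\<lambda>x. f x + g x)" for f g :: "real \<Rightarrow> real"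
proof (induction k arbitrary: f g)
  case 0
  then show ?case by (simp add: continuous_on_add)
next
  case (Suc k)
  show ?case
  proof (rule has_derivative_imp_Ck_Suc)
    show "((\<lambda>x. f x + g x) has_real_derivative deriv f x + deriv g x) (at x)" for x
      by (intro DERIV_add Ck_Suc_imp_deriv(1)[OF Suc.prems(1)] Ck_Suc_imp_deriv(1)[OF Suc.prems(2)])
    show "Ck k (\<lambda>x. deriv f x + deriv g x)"
      using Suc by (meson Ck_Suc_imp_deriv)
  qed
qed

lemma Ck_mult: "Ck k f \<Longrightarrow> Ck k g \<Longrightarrow> Ck k (\<lambda>x. f x * g x)" for f g :: "real \<Rightarrow> real"
proof (induction k arbitrary: f g)
  case 0
  then show ?case by (simp add: continuous_on_mult)
next
  case (Suc k)
  show ?case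
  proof (rule has_derivative_imp_Ck_Suc)
    show "((\<lambda>x. f x * g x) has_real_derivative deriv f x * g x + deriv g x * f x) (at x)" for x
      by (intro DERIV_mult Ck_Suc_imp_deriv(1)[OF Suc.prems(1)] Ck_Suc_imp_deriv(1)[OF Suc.prems(2)])
    show "Ck k (\<lambda>x. deriv f x * g x + deriv g x * f x)"
      using Suc by (intro Ck_add Suc.IH) (auto dest: Ck_Suc_imp_deriv Ck_Suc_mono simp del: Ck.simps)
  qed
qed

lemma Ck_const: "Ck k (\<lambda>x::real. c)" for c :: real
proof (induction k arbitrary: c)
  case (Suc k)
  show ?case
    by (rule has_derivative_imp_Ck_Suc[where g' = "\<lambda>x. 0"]) (simp_all add: Suc del: Ck.simps)
qed simp

lemma Ck_inverse:
  fixes g :: "real \<Rightarrow> real"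
  assumes "\<And>x. g x \<noteq> 0"
  shows "Ck k g \<Longrightarrow> Ck k (\<lambda>x. inverse (g x))"
proof (induction k)
  case 0
  then show ?case using assms by (simp add: continuous_on_inverse)
next
  case (Suc k)
  show ?case
  proof (rule has_derivative_imp_Ck_Suc)
    \<comment> \<open>The derivative -g'/g^2 is spelled as a product so that \<open>Ck_mult\<close>
      and the induction hypothesis apply factor by factor.\<close>
    show "((\<lambda>x. inverse (g x)) has_real_derivative
        (-1) * (deriv g x * (inverse (g x) * inverse (g x)))) (at x)" for x
      using DERIV_inverse_fun[OF Ck_Suc_imp_deriv(1)[OF Suc.prems] assms, of x]
      by (simp add: power2_eq_square)
    show "Ck k (\<lambda>x. (-1) * (deriv g x * (inverse (g x) * inverse (g x))))"
      using Suc by (intro Ck_mult Ck_const Suc.IH) (auto dest: Ck_Suc_imp_deriv Ck_Suc_mono simp del: Ck.simps)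
  qed
qed

text \<open>Later arguments such as \<open>(-1) * x + 1\<close> or
  \<open>(1/\<epsilon>) * t + (-c/\<epsilon>)\<close> are written in exactly this shape so that the
  rule unifies.\<close>

lemma Ck_compose_affine: "Ck k g \<Longrightarrow> Ck k (\<lambda>x. g (c * x + d))" for g :: "real \<Rightarrow> real"
proof (induction k arbitrary: g)
  case 0
  then show ?case
    by (auto intro!: continuous_on_compose2[of UNIV g] continuous_intros)
next
  case (Suc k)
  show ?case
  proof (rule has_derivative_imp_Ck_Suc)
    show "((\<lambda>x. g (c * x + d)) has_real_derivative deriv g (c * x + d) * c) (at x)" for x
      by (rule DERIV_chain2[where f=g and g="\<lambda>x. c * x + d", OF Ck_Suc_imp_deriv(1)[OF Suc.prems]])
        (auto intro!: derivative_eq_intros)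
    show "Ck k (\<lambda>x. deriv g (c * x + d) * c)"
      by (intro Ck_mult Ck_const Suc.IH Ck_Suc_imp_deriv(2)[OF Suc.prems])
  qed
qed

text \<open>The free exponent \<open>m\<close> carries the induction: in \<open>pCons a p\<close>
  the tail appears with one more power of y. The case m = 1 gives the derivative of
  \<open>flat p\<close> at 0.\<close>

lemma tendsto_power_mult_poly_div_exp_0:
  "((\<lambda>y. y ^ m * poly p y / exp y) \<longlongrightarrow> (0::real)) at_top"
proof (induction p arbitrary: m)
  case (pCons a p)
  have "((\<lambda>y. a * (y ^ m / exp y) + y ^ Suc m * poly p y / exp y) \<longlongrightarrow> a * 0 + 0) at_top"
    by (intro tendsto_intros tendsto_power_div_exp_0 pCons)
  moreover have "y ^ m * poly (pCons a p) y / exp y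
      = a * (y ^ m / exp y) + y ^ Suc m * poly p y / exp y" for y
    by (simp add: field_simps)
  ultimately show ?case by simp
qed simp

text \<open>\<open>flat 1\<close> is the classical exp(-1/x) continued by 0; the polynomial in 1/x
  collects the factors that differentiation produces.\<close>

definition flat :: "real poly \<Rightarrow> real \<Rightarrow> real" where
  "flat p x = (if x > 0 then poly p (1/x) * exp (- (1/x)) else 0)"

text \<open>The family is closed under differentiation, with \<open>p\<close> becoming \<open>X\<^sup>2(p - p')\<close>.\<close>

lemma flat_has_derivative:
  "(flat p has_real_derivative flat ([:0,0,1:] * (p - pderiv p)) x) (at x)"
proof -
  consider "x > 0" | "x < 0" | "x = 0" by linarith
  then show ?thesis
  proof cases
    case 1
    have "((\<lambda>x. poly p (1/x) * exp (- (1/x))) has_real_derivative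
        flat ([:0,0,1:] * (p - pderiv p)) x) (at x)"
      using 1 by (auto intro!: derivative_eq_intros DERIV_chain2[OF poly_DERIV]
          simp: flat_def field_simps power2_eq_square)
    then show ?thesis
      by (rule DERIV_cong_ev[THEN iffD1, rotated 3])
        (use 1 in \<open>auto simp: flat_def intro!: eventually_nhds_in_open[of "{0<..}", THEN eventually_mono]\<close>)
  next
    case 2
    have "((\<lambda>x. 0) has_real_derivative flat ([:0,0,1:] * (p - pderiv p)) x) (at x)"
      using 2 by (auto simp: flat_def)
    then show ?thesis
      by (rule DERIV_cong_ev[THEN iffD1, rotated 3])
        (use 2 in \<open>auto simp: flat_def intro!: eventually_nhds_in_open[of "{..<0}", THEN eventually_mono]\<close>)
  next
    case 3
    have "((\<lambda>h. flat p h / h) \<longlongrightarrow> 0) (at_left 0)"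
      by (rule Lim_transform_eventually[OF tendsto_const])
        (auto simp: eventually_at_filter flat_def)
    moreover have "((\<lambda>h. flat p h / h) \<longlongrightarrow> 0) (at_right 0)"
    proof (rule Lim_transform_eventually)
      \<comment> \<open>With y = 1/h the quotient becomes y p(y) exp(-y) as y tends to
        infinity.\<close>
      show "((\<lambda>h::real. (inverse h) ^ 1 * poly p (inverse h) / exp (inverse h)) \<longlongrightarrow> 0) (at_right 0)"
        by (rule filterlim_compose[OF tendsto_power_mult_poly_div_exp_0[where m=1] filterlim_inverse_at_top_right])
      show "\<forall>\<^sub>F h in at_right 0. (inverse h) ^ 1 * poly p (inverse h) / exp (inverse h) = flat p h / h"
        by (auto simp: eventually_at_filter flat_def exp_minus field_simps)
    qed
    ultimately have "((\<lambda>h. flat p h / h) \<longlongrightarrow> 0) (at 0)"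
      by (simp add: filterlim_split_at)
    then show ?thesis
      using 3 by (simp add: has_field_derivative_iff flat_def)
  qed
qed

lemma Ck_flat: "Ck k (flat p)"
proof (induction k arbitrary: p)
  case 0
  have "isCont (flat p) x" for x
    by (rule DERIV_isCont[OF flat_has_derivative])
  then show ?case
    by (simp add: continuous_at_imp_continuous_on)
next
  case (Suc k)
  show ?case
    by (rule has_derivative_imp_Ck_Suc[OF flat_has_derivative Suc])
qed

text \<open>With f = \<open>flat 1\<close> the step is f(x) / (f(x) + f(1 - x)). The denominator is
  positive because x and 1 - x are never both nonpositive.\<close>

lemma smooth_step_exists:
  obtains \<theta> :: "real \<Rightarrow> real" where "smooth \<theta>" "\<And>x. x \<le> 0 \<Longrightarrow> \<theta> x = 0" "\<And>x. x \<ge> 1 \<Longrightarrow> \<theta> x = 1"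
    "\<And>x. 0 \<le> \<theta> x" "\<And>x. \<theta> x \<le> 1"
proof -
  let ?f = "flat 1"
  let ?\<theta> = "\<lambda>x. ?f x * inverse (?f x + ?f ((-1) * x + 1))"
  have nn: "?f x \<ge> 0" for x by (simp add: flat_def)
  have pos: "?f x + ?f ((-1) * x + 1) > 0" for x
    using nn[of x] nn[of "(-1) * x + 1"] by (auto simp: flat_def add_pos_nonneg add_nonneg_pos)
  then have "?f x + ?f ((-1) * x + 1) \<noteq> 0" for x by (metis less_irrefl)
  then have "smooth ?\<theta>"
    unfolding smooth_def by (intro allI Ck_mult Ck_flat Ck_inverse Ck_add Ck_compose_affine)
  moreover have "?\<theta> x = 0" if "x \<le> 0" for x using that by (simp add: flat_def)
  moreover have "?\<theta> x = 1" if "x \<ge> 1" for x using that by (simp add: flat_def)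
  moreover have "?\<theta> x \<ge> 0" for x using nn[of x] pos[of x] by (intro mult_nonneg_nonneg) auto
  moreover have "?\<theta> x \<le> 1" for x
    using nn[of x] nn[of "(-1) * x + 1"] pos[of x] by (simp add: divide_simps flip: divide_inverse)
  ultimately show thesis by (rule that)
qed

section \<open>Weak derivatives in time\<close>

text \<open>Weak derivatives are stated with the Lebesgue integral over the half-line, while the
  mollifier limit uses the gauge integral and its fundamental theorem; this is the bridge.\<close>

lemma integrable_vanishing_outside_Icc:
  fixes g :: "real \<Rightarrow> real"
  assumes cont: "continuous_on {c..d} g" and "0 < c" and zero: "\<And>t. t \<notin> {c..d} \<Longrightarrow> g t = 0"
  shows "integrable (lebesgue_on {0<..}) g"
    and "(LINT t|lebesgue_on {0<..}. g t) = integral {c..d} g"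
proof -
  have sub: "{c..d} \<subseteq> {0<..}" using \<open>0 < c\<close> by auto
  have g: "g = (\<lambda>t. if t \<in> {c..d} then g t else 0)" using zero by auto
  have int: "integrable (lebesgue_on {c..d}) g"
    by (rule continuous_imp_integrable_real[OF cont])
  then have "integrable lebesgue (\<lambda>t. if t \<in> {c..d} then g t else 0)"
    by (subst Lebesgue_Measure.integrable_restrict_UNIV) auto
  then have "integrable lebesgue g" using g by simp
  then show "integrable (lebesgue_on {0<..}) g"
    using integrable_mult_indicator[of "{0<..}" lebesgue g] by (simp add: integrable_restrict_space)
  have "(LINT t|lebesgue_on {0<..}. g t) = (LINT t|lebesgue_on {c..d}. g t)"
    using Lebesgue_Measure.integral_restrict[OF sub, of g] g by simp
  then show "(LINT t|lebesgue_on {0<..}. g t) = integral {c..d} g"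
    using lebesgue_integral_eq_integral[OF int] by simp
qed

text \<open>The kernel lives on \<open>{c..c+\<epsilon>}\<close>, has integral \<theta> 1 - \<theta>
  0 = 1 and size at most K/\<epsilon>, where K bounds the derivative of \<theta> on
  \<open>{0..1}\<close>. Averaging to the right of c admits c = 0.\<close>

lemma integral_mollifier_tendsto:
  fixes \<theta> m :: "real \<Rightarrow> real"
  assumes \<theta>: "smooth \<theta>" "\<theta> 0 = 0" "\<theta> 1 = 1" and m: "continuous_on {0..} m" and c: "0 \<le> c"
  shows "((\<lambda>\<epsilon>. integral {c..c+\<epsilon>} (\<lambda>t. deriv \<theta> ((1/\<epsilon>) * t + (-c/\<epsilon>)) * (1/\<epsilon>) * m t)) \<longlongrightarrow> m c)
    (at_right 0)"
proof -
  have D\<theta>: "(\<theta> has_real_derivative deriv \<theta> x) (at x)" for x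
    using \<theta>(1) Ck_Suc_imp_deriv(1) unfolding smooth_def by blast
  have C\<theta>: "continuous_on UNIV (deriv \<theta>)"
    using \<theta>(1) Ck_Suc_imp_deriv(2) Ck_imp_continuous unfolding smooth_def by blast
  have "compact (deriv \<theta> ` {0..1})"
    by (intro compact_continuous_image continuous_on_subset[OF C\<theta>]) auto
  then obtain K where K: "\<And>x. x \<in> {0..1} \<Longrightarrow> \<bar>deriv \<theta> x\<bar> \<le> K"
    by (force dest!: compact_imp_bounded simp: bounded_iff)
  then have K0: "K \<ge> 0" by (metis abs_ge_zero atLeastAtMost_iff order_trans order_refl zero_le_one)
  show ?thesis
  proof (rule tendstoI)
    fix e :: real assume "e > 0"
    \<comment> \<open>The final error is at most \<open>K * e'\<close>; adding 1 to K keeps the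
      quotient meaningful when K = 0.\<close>
    define e' where "e' = e / (2 * (K + 1))"
    have "e' > 0" using \<open>e > 0\<close> K0 by (simp add: e'_def)
    then obtain d where d: "d > 0" "\<And>t. t \<ge> 0 \<Longrightarrow> \<bar>t - c\<bar> < d \<Longrightarrow> \<bar>m t - m c\<bar> < e'"
      using m c unfolding continuous_on_iff dist_real_def by (metis atLeast_iff)
    have "dist (integral {c..c+\<epsilon>} (\<lambda>t. deriv \<theta> ((1/\<epsilon>) * t + (-c/\<epsilon>)) * (1/\<epsilon>) * m t)) (m c) < e"
      if \<epsilon>: "0 < \<epsilon>" "\<epsilon> < d" for \<epsilon>
    proof -
      let ?k = "\<lambda>t. deriv \<theta> ((1/\<epsilon>) * t + (-c/\<epsilon>)) * (1/\<epsilon>)"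
      have "((\<lambda>t. \<theta> ((1/\<epsilon>) * t + (-c/\<epsilon>))) has_real_derivative ?k t) (at t within A)" for t A
        by (rule has_field_derivative_at_within,
            rule DERIV_chain2[where f=\<theta> and g="\<lambda>t. (1/\<epsilon>) * t + (-c/\<epsilon>)", OF D\<theta>])
          (use \<epsilon> in \<open>auto intro!: derivative_eq_intros\<close>)
      then have "(?k has_integral (\<theta> ((1/\<epsilon>) * (c+\<epsilon>) + (-c/\<epsilon>)) - \<theta> ((1/\<epsilon>) * c + (-c/\<epsilon>)))) {c..c+\<epsilon>}"
        using \<epsilon> by (intro fundamental_theorem_of_calculus)
          (auto simp flip: has_real_derivative_iff_has_vector_derivative)
      moreover have "(1/\<epsilon>) * (c+\<epsilon>) + (-c/\<epsilon>) = 1" "(1/\<epsilon>) * c + (-c/\<epsilon>) = 0"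
        using \<epsilon> by (auto simp: field_simps)
      ultimately have k1: "(?k has_integral 1) {c..c+\<epsilon>}"
        using \<theta> by (metis diff_zero)
      have km: "continuous_on {c..c+\<epsilon>} (\<lambda>t. ?k t * m t)"
        by (intro continuous_intros continuous_on_compose2[OF C\<theta>] continuous_on_subset[OF m])
          (use c in auto)
      have "((\<lambda>t. ?k t * m t - ?k t * m c) has_integral
          (integral {c..c+\<epsilon>} (\<lambda>t. ?k t * m t) - 1 * m c)) {c..c+\<epsilon>}"
        by (intro has_integral_diff integrable_integral integrable_continuous_interval km
            has_integral_mult_left k1)
      moreover have "norm (?k t * m t - ?k t * m c) \<le> K / \<epsilon> * e'" if "t \<in> {c..c+\<epsilon>}" for t
      proof -
        have "(1/\<epsilon>) * t + (-c/\<epsilon>) \<in> {0..1}"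
          using that \<epsilon> by (auto simp: field_simps)
        then have "\<bar>?k t\<bar> \<le> K / \<epsilon>"
          using K \<epsilon> by (simp add: abs_mult divide_right_mono)
        moreover have "\<bar>m t - m c\<bar> \<le> e'"
          using d(2)[of t] that \<epsilon> c by auto
        ultimately have "\<bar>?k t\<bar> * \<bar>m t - m c\<bar> \<le> K / \<epsilon> * e'"
          using K0 \<epsilon> by (intro mult_mono) auto
        then show ?thesis
          by (simp only: real_norm_def right_diff_distrib[symmetric] abs_mult)
      qed
      ultimately have "norm (integral {c..c+\<epsilon>} (\<lambda>t. ?k t * m t) - 1 * m c)
          \<le> K / \<epsilon> * e' * measure lborel (cbox c (c+\<epsilon>))"
        using has_integral_bound[of "K / \<epsilon> * e'" "\<lambda>t. ?k t * m t - ?k t * m c" _ c "c+\<epsilon>"]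
          K0 \<epsilon> \<open>e' > 0\<close> by auto
      also have "\<dots> = K * e'" using \<epsilon> by simp
      also have "\<dots> < e"
        using K0 \<open>e > 0\<close> by (simp add: e'_def field_simps add_nonneg_pos)
      finally show ?thesis by (simp add: dist_real_def)
    qed
    then show "\<forall>\<^sub>F \<epsilon> in at_right 0.
        dist (integral {c..c+\<epsilon>} (\<lambda>t. deriv \<theta> ((1/\<epsilon>) * t + (-c/\<epsilon>)) * (1/\<epsilon>) * m t)) (m c) < e"
      unfolding eventually_at_right_field using d(1) by blast
  qed
qed

text \<open>The scalar counterpart of \<open>Linf_time\<close>: time integrands of this kind are
  integrable on every bounded interval of \<open>{0..}\<close>.\<close>

definition ess_bounded :: "(real \<Rightarrow> real) \<Rightarrow> bool" where
  "ess_bounded q \<longleftrightarrow> q \<in> borel_measurable (lebesgue_on {0<..}) \<and>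
     (\<exists>C. AE t in lebesgue_on {0<..}. \<bar>q t\<bar> \<le> C)"

text \<open>Hypotheses live on the open half-line while time intervals may start at 0; the point 0
  is a null set.\<close>

lemma AE_lebesgue_on_Icc:
  assumes "AE t in lebesgue_on {0<..}. P t" "0 \<le> (a::real)"
  shows "AE t in lebesgue_on {a..b}. P t"
proof -
  have "AE t in lebesgue. t \<noteq> (0::real)"
    using AE_completion AE_lborel_singleton by blast
  then have "AE t in lebesgue. t \<in> {a..b} \<longrightarrow> P t"
    using assms by (auto simp: AE_restrict_space_iff)
  then show ?thesis
    by (simp add: AE_restrict_space_iff)
qed

lemma borel_measurable_lebesgue_on_Icc:
  fixes q :: "real \<Rightarrow> real"
  assumes "q \<in> borel_measurable (lebesgue_on {0<..})" "0 \<le> a"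
  shows "q \<in> borel_measurable (lebesgue_on {a..b})"
proof -
  have "(\<lambda>t. if t \<in> {0<..} then q t else 0) \<in> borel_measurable lebesgue"
    using assms by (subst borel_measurable_if) auto
  \<comment> \<open>The two extensions by zero can differ only at t = 0.\<close>
  moreover have "AE t in lebesgue. (if t \<in> {0<..} then q t else 0) = (if t \<in> {0..} then q t else 0)"
    using AE_completion[OF AE_lborel_singleton[of 0]] by eventually_elim auto
  ultimately have "(\<lambda>t. if t \<in> {0..} then q t else 0) \<in> borel_measurable lebesgue"
    by (rule borel_measurable_AE)
  then have "q \<in> borel_measurable (lebesgue_on {0..})"
    by (rule borel_measurable_if_D)
  then show ?thesis
    by (rule measurable_restrict_mono) (use assms in auto)
qed

lemma finite_measure_lebesgue_on_Icc: "finite_measure (lebesgue_on {a..b::real})"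
  by (rule finite_measure_lebesgue_on) auto

lemma ess_bounded_integrable:
  assumes "ess_bounded q" "0 \<le> a"
  shows "integrable (lebesgue_on {a..b}) q"
proof -
  obtain C where "AE t in lebesgue_on {0<..}. \<bar>q t\<bar> \<le> C"
    using assms by (auto simp: ess_bounded_def)
  then have "AE t in lebesgue_on {a..b}. norm (q t) \<le> C"
    using AE_lebesgue_on_Icc assms by force
  then show ?thesis
    using finite_measure.integrable_const_bound[OF finite_measure_lebesgue_on_Icc]
      borel_measurable_lebesgue_on_Icc assms unfolding ess_bounded_def by blast
qed

lemma integral_lebesgue_on_Icc_bound:
  assumes "integrable (lebesgue_on {a..b}) q" "AE t in lebesgue_on {a..b}. q t \<le> C" "a \<le> b"
  shows "(LINT t|lebesgue_on {a..b}. q t) \<le> C * (b - a::real)"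
proof -
  have "(LINT t|lebesgue_on {a..b}. q t) \<le> (LINT t|lebesgue_on {a..b}. C)"
    using assms by (intro integral_mono_AE) auto
  then show ?thesis
    using assms(3) by (simp add: measure_restrict_space mult.commute)
qed

text \<open>The test function is \<theta>((t - a)/\<epsilon>) - \<theta>((t - b)/\<epsilon>), which
  tends to the indicator of (a, b]. Its derivative is a difference of two mollifiers, whence m a - m
  b; the other side converges by dominated convergence. Positivity of a keeps the support inside the
  open half-line.\<close>

lemma weak_derivative_FTC_pos:
  fixes m q :: "real \<Rightarrow> real"
  assumes m: "continuous_on {0..} m" and q: "ess_bounded q"
    and weak: "\<And>\<phi>. test_function {0<..} \<phi> \<Longrightarrow>
      (LINT t|lebesgue_on {0<..}. deriv \<phi> t * m t) = - (LINT t|lebesgue_on {0<..}. \<phi> t * q t)"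
    and ab: "0 < a" "a < b"
  shows "m b - m a = (LINT t|lebesgue_on {a..b}. q t)"
proof -
  obtain \<theta> :: "real \<Rightarrow> real" where \<theta>: "smooth \<theta>" "\<And>x. x \<le> 0 \<Longrightarrow> \<theta> x = 0" "\<And>x. x \<ge> 1 \<Longrightarrow> \<theta> x = 1"
    "\<And>x. 0 \<le> \<theta> x" "\<And>x. \<theta> x \<le> 1"
    using smooth_step_exists by blast
  have D\<theta>: "(\<theta> has_real_derivative deriv \<theta> x) (at x)" for x
    using \<theta>(1) Ck_Suc_imp_deriv(1) unfolding smooth_def by blast
  have C\<theta>: "continuous_on UNIV (deriv \<theta>)"
    using \<theta>(1) Ck_Suc_imp_deriv(2) Ck_imp_continuous unfolding smooth_def by blast
  have C\<theta>0: "continuous_on UNIV \<theta>"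
    using \<theta>(1) Ck_imp_continuous unfolding smooth_def by blast
  have D0: "deriv \<theta> x = 0" if "x \<notin> {0..1}" for x
  proof (cases "x < 0")
    case True
    have "(\<theta> has_real_derivative 0) (at x)"
      by (rule DERIV_cong_ev[THEN iffD2, of x x _ "\<lambda>x. 0"])
        (use True \<theta> in \<open>auto intro!: eventually_nhds_in_open[of "{..<0}", THEN eventually_mono]\<close>)
    then show ?thesis by (rule DERIV_imp_deriv)
  next
    case False
    then have "x > 1" using that by auto
    have "(\<theta> has_real_derivative 0) (at x)"
      by (rule DERIV_cong_ev[THEN iffD2, of x x _ "\<lambda>x. 1"])
        (use \<open>x > 1\<close> \<theta> in \<open>auto intro!: eventually_nhds_in_open[of "{1<..}", THEN eventually_mono]\<close>)
    then show ?thesis by (rule DERIV_imp_deriv)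
  qed
  \<comment> \<open>Dominated convergence asks for a sequence; \<open>\<epsilon> n \<le> 1\<close>
    puts all supports into \<open>{a..b+1}\<close>, where the constant bound is integrable.\<close>
  define \<epsilon> where "\<epsilon> n = 1 / (real n + 1)" for n :: nat
  have \<epsilon>: "\<epsilon> n > 0" "\<epsilon> n \<le> 1" for n by (auto simp: \<epsilon>_def)
  have \<epsilon>lim: "\<epsilon> \<longlonglongrightarrow> 0"
  proof -
    have "\<epsilon> n = inverse (real (Suc n))" for n
      by (simp add: \<epsilon>_def inverse_eq_divide)
    then show ?thesis
      using LIMSEQ_inverse_real_of_nat by presburger
  qed
  have "\<forall>\<^sub>F n in sequentially. \<epsilon> n \<in> {0<..} \<and> \<epsilon> n \<noteq> 0"
    by (rule always_eventually) (simp add: \<epsilon>(1) less_imp_neq[OF \<epsilon>(1), symmetric])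
  then have \<epsilon>0: "filterlim \<epsilon> (at_right 0) sequentially"
    using \<epsilon>lim by (simp add: filterlim_at)
  let ?k = "\<lambda>c n t. deriv \<theta> ((1/\<epsilon> n) * t + (-c/\<epsilon> n)) * (1/\<epsilon> n)"
  let ?\<theta> = "\<lambda>c n t. \<theta> ((1/\<epsilon> n) * t + (-c/\<epsilon> n))"
  have arg: "(1/\<epsilon> n) * t + (-c/\<epsilon> n) = (t - c) / \<epsilon> n" for n t c
    by (simp only: diff_divide_distrib) simp
  have k0: "?k c n t = 0" if "t \<notin> {c..c + \<epsilon> n}" for c n t
  proof -
    have "(t - c) / \<epsilon> n \<notin> {0..1}"
      using that \<epsilon>(1)[of n] by (auto simp: zero_le_divide_iff)
    then show ?thesis
      unfolding arg by (simp add: D0)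
  qed
  have kcont: "continuous_on A (\<lambda>t. ?k c n t * m t)" if "A \<subseteq> {0..}" for A c n
    by (intro continuous_on_mult continuous_on_const continuous_on_add continuous_on_id
        continuous_on_compose2[OF C\<theta>] continuous_on_subset[OF m that]) auto
  define \<phi> where "\<phi> n t = ?\<theta> a n t + (-1) * ?\<theta> b n t" for n t
  have D\<phi>: "deriv (\<phi> n) t = ?k a n t - ?k b n t" for n t
  proof -
    have "(?\<theta> c n has_real_derivative ?k c n t) (at t)" for c
      by (rule DERIV_chain2[where f=\<theta> and g="\<lambda>t. (1/\<epsilon> n) * t + (-c/\<epsilon> n)", OF D\<theta>])
        (use \<epsilon>[of n] in \<open>auto intro!: derivative_eq_intros\<close>)
    then have "(\<phi> n has_real_derivative ?k a n t - ?k b n t) (at t)"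
      unfolding \<phi>_def using DERIV_diff by force
    then show ?thesis by (rule DERIV_imp_deriv)
  qed
  have \<phi>0: "\<phi> n t = 0" if "t \<notin> {a..b + \<epsilon> n}" for n t
  proof (cases "t < a")
    case True
    then have "(t - a) / \<epsilon> n \<le> 0" "(t - b) / \<epsilon> n \<le> 0"
      using ab \<epsilon>(1)[of n] by (auto simp: divide_le_0_iff)
    then show ?thesis unfolding \<phi>_def arg by (simp add: \<theta>(2))
  next
    case False
    then have "(t - a) / \<epsilon> n \<ge> 1" "(t - b) / \<epsilon> n \<ge> 1"
      using ab \<epsilon>(1)[of n] that by auto
    then show ?thesis unfolding \<phi>_def arg by (simp add: \<theta>(3))
  qed
  have test: "test_function {0<..} (\<phi> n)" for n
  proof -
    have sub: "{t. \<phi> n t \<noteq> 0} \<subseteq> {a..b + \<epsilon> n}"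
      using \<phi>0[of _ n] by blast
    then have "closure {t. \<phi> n t \<noteq> 0} \<subseteq> {a..b + \<epsilon> n}"
      by (intro closure_minimal) auto
    moreover have "bounded {t. \<phi> n t \<noteq> 0}"
      by (rule bounded_subset[OF bounded_closed_interval sub])
    moreover have "smooth (\<phi> n)"
      unfolding smooth_def \<phi>_def using \<theta>(1)
      by (intro allI Ck_add Ck_mult Ck_const Ck_compose_affine) (auto simp: smooth_def)
    ultimately show ?thesis
      unfolding test_function_def using ab(1) by (auto simp: compact_closure)
  qed
  have lhs: "(LINT t|lebesgue_on {0<..}. deriv (\<phi> n) t * m t)
      = integral {a..a+\<epsilon> n} (\<lambda>t. ?k a n t * m t) - integral {b..b+\<epsilon> n} (\<lambda>t. ?k b n t * m t)" for n
  proof -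
    have "integrable (lebesgue_on {0<..}) (\<lambda>t. ?k c n t * m t)"
      "(LINT t|lebesgue_on {0<..}. ?k c n t * m t) = integral {c..c+\<epsilon> n} (\<lambda>t. ?k c n t * m t)"
      if "0 < c" for c
      using that k0[of _ c n]
    proof -
      have c: "continuous_on {c..c + \<epsilon> n} (\<lambda>t. ?k c n t * m t)"
        using that by (intro kcont) auto
      have z: "?k c n t * m t = 0" if "t \<notin> {c..c + \<epsilon> n}" for t
        by (simp only: k0[OF that] mult_zero_left)
      show "integrable (lebesgue_on {0<..}) (\<lambda>t. ?k c n t * m t)"
        "(LINT t|lebesgue_on {0<..}. ?k c n t * m t) = integral {c..c+\<epsilon> n} (\<lambda>t. ?k c n t * m t)"
        by (rule integrable_vanishing_outside_Icc[OF c that z]; assumption)+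
    qed
    from this[of a] this[of b] show ?thesis
      using ab unfolding D\<phi> left_diff_distrib by (simp only: Bochner_Integration.integral_diff)
  qed
  have lim1: "(\<lambda>n. LINT t|lebesgue_on {0<..}. deriv (\<phi> n) t * m t) \<longlonglongrightarrow> m a - m b"
    unfolding lhs
    by (intro tendsto_diff filterlim_compose[OF integral_mollifier_tendsto[OF \<theta>(1) _ _ m] \<epsilon>0])
      (use ab \<theta>(2)[of 0] \<theta>(3)[of 1] in simp_all)
  obtain C where C: "AE t in lebesgue_on {0<..}. \<bar>q t\<bar> \<le> C"
    using q by (auto simp: ess_bounded_def)
  have qm: "q \<in> borel_measurable (lebesgue_on {0<..})"
    using q by (simp add: ess_bounded_def)
  have lim2: "(\<lambda>n. LINT t|lebesgue_on {0<..}. \<phi> n t * q t)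
      \<longlonglongrightarrow> (LINT t|lebesgue_on {0<..}. indicator {a<..b} t * q t)"
  proof (rule integral_dominated_convergence)
    show "integrable (lebesgue_on {0<..}) (\<lambda>t. C * indicator {a..b+1} t)"
    proof -
      have "emeasure (lebesgue_on {0<..}) {a..b+1} < \<infinity>"
        using ab by (subst emeasure_restrict_space) auto
      then have "integrable (lebesgue_on {0<..}) (indicat_real {a..b+1})"
        using ab by (intro integrable_real_indicator) (auto simp: sets_restrict_space_iff)
      then show ?thesis by simp
    qed
    have \<theta>m: "?\<theta> c n \<in> borel_measurable (lebesgue_on {0<..})" for c n
      by (intro continuous_imp_measurable_on_sets_lebesgue continuous_on_compose2[OF C\<theta>0] continuous_intros) auto
    show "(\<lambda>t. \<phi> n t * q t) \<in> borel_measurable (lebesgue_on {0<..})" for n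
      unfolding \<phi>_def by (intro borel_measurable_times borel_measurable_add borel_measurable_const \<theta>m qm)
    show "(\<lambda>t. indicator {a<..b} t * q t) \<in> borel_measurable (lebesgue_on {0<..})"
      using ab qm by (intro borel_measurable_times borel_measurable_indicator) (auto simp: sets_restrict_space_iff)
    show "AE t in lebesgue_on {0<..}. norm (\<phi> n t * q t) \<le> C * indicator {a..b+1} t" for n
      using C
    proof eventually_elim
      case (elim t)
      have "\<bar>\<phi> n t\<bar> \<le> 1"
        using \<theta>(4,5)[of "(1/\<epsilon> n) * t + (-a/\<epsilon> n)"] \<theta>(4,5)[of "(1/\<epsilon> n) * t + (-b/\<epsilon> n)"]
        unfolding \<phi>_def by linarith
      then have "\<bar>\<phi> n t\<bar> * \<bar>q t\<bar> \<le> 1 * C"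
        using elim by (intro mult_mono) auto
      moreover have "\<phi> n t = 0" if "t \<notin> {a..b+1}"
        using \<phi>0[of t n] \<epsilon>[of n] that by auto
      ultimately show ?case by (auto simp: abs_mult indicator_def)
    qed
    show "AE t in lebesgue_on {0<..}. (\<lambda>n. \<phi> n t * q t) \<longlonglongrightarrow> indicator {a<..b} t * q t"
    proof (intro AE_I2 tendsto_mult tendsto_const)
      fix t
      \<comment> \<open>At t = c the value is \<theta> 0 = 0 for every n, so the limit is the
        indicator of the open ray and the difference gives a half-open interval.\<close>
      have step: "(\<lambda>n. ?\<theta> c n t) \<longlonglongrightarrow> indicator {c<..} t" for c
      proof (cases "t > c")
        case True
        have "\<forall>\<^sub>F n in sequentially. \<epsilon> n < t - c"
          using True by (intro order_tendstoD(2)[OF \<epsilon>lim]) simp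
        then have "\<forall>\<^sub>F n in sequentially. ?\<theta> c n t = 1"
        proof eventually_elim
          case (elim n)
          then have "(t - c) / \<epsilon> n \<ge> 1" using \<epsilon>(1)[of n] by auto
          then show ?case unfolding arg by (rule \<theta>(3))
        qed
        then show ?thesis using True tendsto_eventually by auto
      next
        case False
        then have "?\<theta> c n t = 0" for n
          using \<epsilon>(1)[of n] unfolding arg by (intro \<theta>(2)) (auto simp: divide_nonpos_pos)
        then show ?thesis using False by simp
      qed
      have "(\<lambda>n. \<phi> n t) \<longlonglongrightarrow> indicator {a<..} t + (-1) * indicator {b<..} t"
        unfolding \<phi>_def by (intro tendsto_intros step)
      moreover have "indicator {a<..} t + (-1) * indicator {b<..} t = (indicator {a<..b} t :: real)"
        using ab by (auto simp: indicator_def)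
      ultimately show "(\<lambda>n. \<phi> n t) \<longlonglongrightarrow> indicator {a<..b} t" by simp
    qed
  qed
  have "(\<lambda>n. LINT t|lebesgue_on {0<..}. deriv (\<phi> n) t * m t)
      \<longlonglongrightarrow> - (LINT t|lebesgue_on {0<..}. indicator {a<..b} t * q t)"
    unfolding weak[OF test] by (rule tendsto_minus[OF lim2])
  then have "- (LINT t|lebesgue_on {0<..}. indicator {a<..b} t * q t) = m a - m b"
    by (rule LIMSEQ_unique[OF _ lim1])
  moreover have "(LINT t|lebesgue_on {0<..}. indicator {a<..b} t * q t)
      = (LINT t|lebesgue_on {a<..b}. q t)"
  proof -
    have "(\<lambda>t. indicator {a<..b} t * q t) = (\<lambda>t. if t \<in> {a<..b} then q t else 0)"
      by (auto simp: indicator_def)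
    then show ?thesis
      using Lebesgue_Measure.integral_restrict[of "{a<..b}" "{0<..}" q] ab(1) by force
  qed
  moreover have "(LINT t|lebesgue_on {a<..b}. q t) = (LINT t|lebesgue_on {a..b}. q t)"
  proof -
    have "(LINT t|lebesgue_on {a..b}. q t) = (LINT t|lebesgue_on {a..b}. (if t \<in> {a<..b} then q t else 0))"
    proof (rule integral_cong_AE)
      have qab: "q \<in> borel_measurable (lebesgue_on {a..b})"
        by (rule borel_measurable_lebesgue_on_Icc[OF qm]) (use ab in auto)
      show "q \<in> borel_measurable (lebesgue_on {a..b})" by (rule qab)
      show "(\<lambda>t. if t \<in> {a<..b} then q t else 0) \<in> borel_measurable (lebesgue_on {a..b})"
        by (intro measurable_If_set qab) (auto simp: sets_restrict_space_iff)
      show "AE t in lebesgue_on {a..b}. q t = (if t \<in> {a<..b} then q t else 0)"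
        using AE_completion[OF AE_lborel_singleton[of a]] by (auto simp: AE_restrict_space_iff)
    qed
    also have "\<dots> = (LINT t|lebesgue_on {a<..b}. q t)"
      by (rule Lebesgue_Measure.integral_restrict) auto
    finally show ?thesis by simp
  qed
  ultimately show ?thesis by simp
qed

text \<open>No test function reaches the endpoint 0. Both sides are continuous in the lower limit,
  so the defect \<open>d\<close>, which vanishes on (0, b), vanishes at 0 as well.\<close>

lemma weak_derivative_FTC:
  fixes m q :: "real \<Rightarrow> real"
  assumes m: "continuous_on {0..} m" and q: "ess_bounded q"
    and weak: "\<And>\<phi>. test_function {0<..} \<phi> \<Longrightarrow>
      (LINT t|lebesgue_on {0<..}. deriv \<phi> t * m t) = - (LINT t|lebesgue_on {0<..}. \<phi> t * q t)"
    and ab: "0 \<le> a" "a \<le> b"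
  shows "m b - m a = (LINT t|lebesgue_on {a..b}. q t)"
proof -
  consider "a = b" | "0 < a" "a < b" | "a = 0" "0 < b" using ab by linarith
  then show ?thesis
  proof cases
    case 1
    then show ?thesis
      using lebesgue_integral_eq_integral[OF ess_bounded_integrable[OF q, of a b]] ab by simp
  next
    case 2
    show ?thesis by (rule weak_derivative_FTC_pos[OF m q weak 2])
  next
    case 3
    define d where "d x = m b - m x - ((LINT t|lebesgue_on {0..b}. q t) - (LINT t|lebesgue_on {0..x}. q t))" for x
    have "d x = 0" if "x \<in> {0<..<b}" for x
      using weak_derivative_FTC_pos[OF m q weak, of x b]
        Equivalence_Measurable_On_Borel.integral_combine[OF ess_bounded_integrable[OF q], of 0 x b] that
      by (simp add: d_def)
    moreover have "continuous_on (closure {0<..<b}) d"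
      using 3 unfolding d_def
      by (auto intro!: continuous_intros continuous_on_subset[OF m]
          indefinite_integral_continuous_real ess_bounded_integrable q)
    moreover have "0 \<in> closure {0<..<b}"
      using 3 by simp
    ultimately have "d 0 = 0"
      using continuous_constant_on_closure by blast
    moreover have "(LINT t|lebesgue_on {0..0}. q t) = 0"
      using lebesgue_integral_eq_integral[OF ess_bounded_integrable[OF q, of 0 0]] by simp
    ultimately show ?thesis
      using 3 by (simp add: d_def)
  qed
qed

section \<open>Steklov means\<close>

lemma integrable_lebesgue_on_Icc_shift:
  fixes q :: "real \<Rightarrow> real"
  assumes "integrable (lebesgue_on {a-h..b-h}) q"
  shows "integrable (lebesgue_on {a..b}) (\<lambda>t. q (t - h))"
    and "(LINT t|lebesgue_on {a..b}. q (t - h)) = (LINT t|lebesgue_on {a-h..b-h}. q t)"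
proof -
  have abs: "q absolutely_integrable_on {a-h..b-h}"
    using assms by (simp add: absolutely_integrable_on_def integrable_on_lebesgue_on)
  then have "(\<lambda>t. q (t - h)) absolutely_integrable_on {a..b}"
    using integrable_shift_real_ivl[of q "a-h" "b-h" "-h"]
      integrable_shift_real_ivl[of "\<lambda>t. norm (q t)" "a-h" "b-h" "-h"]
    by (simp add: absolutely_integrable_on_def)
  then show int: "integrable (lebesgue_on {a..b}) (\<lambda>t. q (t - h))"
    by (simp add: absolutely_integrable_measurable_real integrable_abs_iff set_integrable_def integrable_restrict_space)
  show "(LINT t|lebesgue_on {a..b}. q (t - h)) = (LINT t|lebesgue_on {a-h..b-h}. q t)"
    using lebesgue_integral_eq_integral[OF int] lebesgue_integral_eq_integral[OF assms]
      integral_shift_real_ivl[of "a-h" "-h" "b-h" q] by simp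
qed

text \<open>After the shift both integrals are completed to the one over \<open>{s..T}\<close>, so
  only the two end windows remain. For an energy q this yields boundary terms without
  differentiating q.\<close>

lemma integral_backward_difference:
  fixes q :: "real \<Rightarrow> real"
  assumes q: "integrable (lebesgue_on {s..T}) q" and h: "0 \<le> h" "s + h \<le> T"
  shows "integrable (lebesgue_on {s+h..T}) (\<lambda>t. q t - q (t - h))"
    and "(LINT t|lebesgue_on {s+h..T}. q t - q (t - h))
      = (LINT t|lebesgue_on {T-h..T}. q t) - (LINT t|lebesgue_on {s..s+h}. q t)"
proof -
  have i: "integrable (lebesgue_on {c..d}) q" if "s \<le> c" "d \<le> T" for c d
    using integrable_subinterval[OF q] that by auto
  have j: "integrable (lebesgue_on {s+h..T}) (\<lambda>t. q (t - h))"
    using h by (intro integrable_lebesgue_on_Icc_shift i) auto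
  then show "integrable (lebesgue_on {s+h..T}) (\<lambda>t. q t - q (t - h))"
    using h by (intro Bochner_Integration.integrable_diff i) auto
  have "(LINT t|lebesgue_on {s+h..T}. q t - q (t - h))
      = (LINT t|lebesgue_on {s+h..T}. q t) - (LINT t|lebesgue_on {s..T-h}. q t)"
    using integrable_lebesgue_on_Icc_shift(2)[of "s+h" h T q] i[of s "T-h"] i[of "s+h" T] h j
    by (simp add: Bochner_Integration.integral_diff)
  then show "(LINT t|lebesgue_on {s+h..T}. q t - q (t - h))
      = (LINT t|lebesgue_on {T-h..T}. q t) - (LINT t|lebesgue_on {s..s+h}. q t)"
    using Equivalence_Measurable_On_Borel.integral_combine[OF q, of "s+h"]
      Equivalence_Measurable_On_Borel.integral_combine[OF q, of "T-h"] h by simp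
qed

lemma integral_window:
  fixes q :: "real \<Rightarrow> real"
  assumes q: "integrable (lebesgue_on {s..T}) q" and "s \<le> t - h" "t \<le> T" "0 \<le> h"
  shows "(LINT x|lebesgue_on {t-h..t}. q x)
    = (LINT x|lebesgue_on {s..t}. q x) - (LINT x|lebesgue_on {s..t-h}. q x)"
  using Equivalence_Measurable_On_Borel.integral_combine[of s t q "t-h"]
    integrable_subinterval[OF q, of s t] assms by auto

text \<open>A window integral is R t - R (t - h) with R the primitive of q, so the preceding lemma
  applied to R replaces Fubini. For q \<ge> 0, R is nonnegative and increasing, and the last window
  of R is at most h R(T).\<close>

lemma integrable_window:
  fixes q :: "real \<Rightarrow> real"
  assumes q: "integrable (lebesgue_on {s..T}) q" and h: "0 \<le> h" "s + h \<le> T"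
  shows "integrable (lebesgue_on {s+h..T}) (\<lambda>t. LINT x|lebesgue_on {t-h..t}. q x)"
    and "(\<And>t. q t \<ge> 0) \<Longrightarrow> (LINT t|lebesgue_on {s+h..T}. LINT x|lebesgue_on {t-h..t}. q x)
      \<le> h * (LINT x|lebesgue_on {s..T}. q x)"
proof -
  let ?R = "\<lambda>t. LINT x|lebesgue_on {s..t}. q x"
  have R: "continuous_on {s..T} ?R"
    by (rule indefinite_integral_continuous_real[OF q])
  have iR: "integrable (lebesgue_on {c..d}) ?R" if "s \<le> c" "d \<le> T" for c d
    using that by (intro continuous_imp_integrable_real continuous_on_subset[OF R]) auto
  have eq: "(LINT x|lebesgue_on {t-h..t}. q x) = ?R t - ?R (t - h)" if "t \<in> {s+h..T}" for t
    using that h by (intro integral_window[OF q]) auto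
  show "integrable (lebesgue_on {s+h..T}) (\<lambda>t. LINT x|lebesgue_on {t-h..t}. q x)"
  proof (subst Bochner_Integration.integrable_cong[OF refl])
    show "(LINT x|lebesgue_on {t-h..t}. q x) = ?R t - ?R (t - h)"
      if "t \<in> space (lebesgue_on {s+h..T})" for t
      using eq that by simp
    show "integrable (lebesgue_on {s+h..T}) (\<lambda>t. ?R t - ?R (t - h))"
      using h by (intro integral_backward_difference(1) iR) auto
  qed
  assume nn: "\<And>t. q t \<ge> 0"
  have "(LINT t|lebesgue_on {s+h..T}. LINT x|lebesgue_on {t-h..t}. q x)
      = (LINT t|lebesgue_on {s+h..T}. ?R t - ?R (t - h))"
    using eq by (intro Bochner_Integration.integral_cong) auto
  also have "\<dots> = (LINT t|lebesgue_on {T-h..T}. ?R t) - (LINT t|lebesgue_on {s..s+h}. ?R t)"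
    using h by (intro integral_backward_difference(2) iR) auto
  also have "\<dots> \<le> (LINT t|lebesgue_on {T-h..T}. ?R t)"
    using nn by (simp add: Bochner_Integration.integral_nonneg)
  also have "\<dots> \<le> ?R T * (T - (T - h))"
  proof (rule integral_lebesgue_on_Icc_bound)
    show "integrable (lebesgue_on {T-h..T}) ?R" using h by (intro iR) auto
    have "0 \<le> (LINT x|lebesgue_on {t..T}. q x)" for t
      using nn by (simp add: Bochner_Integration.integral_nonneg)
    then have "?R t \<le> ?R T" if "t \<in> {T-h..T}" for t
      using Equivalence_Measurable_On_Borel.integral_combine[OF q, of t] that h by auto
    then show "AE t in lebesgue_on {T-h..T}. ?R t \<le> ?R T" by (intro AE_I2) auto
  qed (use h in auto)
  finally show "(LINT t|lebesgue_on {s+h..T}. LINT x|lebesgue_on {t-h..t}. q x)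
      \<le> h * (LINT x|lebesgue_on {s..T}. q x)" by (simp add: mult.commute)
qed

text \<open>A measurable function is an almost everywhere limit of continuous ones; truncating these
  at the essential bound makes dominated convergence applicable and does not change the
  limit.\<close>

lemma ess_bounded_approx_continuous:
  assumes \<psi>: "ess_bounded \<psi>" and "0 \<le> s" "\<epsilon> > 0"
  obtains g where "continuous_on UNIV g" "(LINT t|lebesgue_on {s..T}. \<bar>\<psi> t - g t\<bar>) < \<epsilon>"
proof -
  obtain C0 where C0: "AE t in lebesgue_on {0<..}. \<bar>\<psi> t\<bar> \<le> C0"
    using \<psi> by (auto simp: ess_bounded_def)
  \<comment> \<open>The absolute value makes \<open>{-C..C}\<close> a genuine interval, as the
    truncation requires.\<close>
  define C where "C = \<bar>C0\<bar>"
  have C: "AE t in lebesgue_on {s..T}. \<bar>\<psi> t\<bar> \<le> C"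
    using AE_lebesgue_on_Icc[OF C0 \<open>0 \<le> s\<close>] by eventually_elim (auto simp: C_def)
  have "\<psi> measurable_on {0<..}"
    using \<psi> by (simp add: ess_bounded_def measurable_on_iff_borel_measurable)
  then obtain N g where N: "negligible N" and g: "\<And>n. continuous_on UNIV (g n)"
    and lim: "\<And>t. t \<notin> N \<Longrightarrow> (\<lambda>n. g n t) \<longlonglongrightarrow> (if t \<in> {0<..} then \<psi> t else 0)"
    unfolding measurable_on_def by blast
  define g' where "g' n t = max (-C) (min C (g n t))" for n t
  have g': "continuous_on UNIV (g' n)" for n
    unfolding g'_def by (intro continuous_intros g)
  have "AE t in lebesgue. t \<notin> N"
    using N by (simp add: AE_not_in negligible_iff_null_sets)
  then have "AE t in lebesgue. t \<in> {0<..} \<longrightarrow> (\<lambda>n. g n t) \<longlonglongrightarrow> \<psi> t"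
  proof eventually_elim
    case (elim t)
    then show ?case using lim[of t] by auto
  qed
  then have "AE t in lebesgue_on {0<..}. (\<lambda>n. g n t) \<longlonglongrightarrow> \<psi> t"
    by (simp add: AE_restrict_space_iff)
  then have "AE t in lebesgue_on {s..T}. (\<lambda>n. g n t) \<longlonglongrightarrow> \<psi> t"
    using AE_lebesgue_on_Icc \<open>0 \<le> s\<close> by blast
  with C have lim': "AE t in lebesgue_on {s..T}. (\<lambda>n. \<bar>\<psi> t - g' n t\<bar>) \<longlonglongrightarrow> 0"
  proof eventually_elim
    case (elim t)
    have "(\<lambda>n. \<bar>\<psi> t - g' n t\<bar>) \<longlonglongrightarrow> \<bar>\<psi> t - max (-C) (min C (\<psi> t))\<bar>"
      unfolding g'_def by (intro tendsto_intros elim)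
    moreover have "max (-C) (min C (\<psi> t)) = \<psi> t" using elim(1) by auto
    ultimately show ?case by simp
  qed
  have bound: "AE t in lebesgue_on {s..T}. norm \<bar>\<psi> t - g' n t\<bar> \<le> 2 * C" for n
    using C
  proof eventually_elim
    case (elim t)
    have "\<bar>g' n t\<bar> \<le> C" by (auto simp: g'_def C_def)
    with elim show ?case by auto
  qed
  have \<psi>m: "\<psi> \<in> borel_measurable (lebesgue_on {s..T})"
    using \<psi> by (intro borel_measurable_lebesgue_on_Icc \<open>0 \<le> s\<close>) (simp add: ess_bounded_def)
  have g'm: "g' n \<in> borel_measurable (lebesgue_on {s..T})" for n
    by (rule continuous_imp_measurable_on_sets_lebesgue[OF continuous_on_subset[OF g']]) auto
  have "(\<lambda>n. LINT t|lebesgue_on {s..T}. \<bar>\<psi> t - g' n t\<bar>) \<longlonglongrightarrow> (LINT t|lebesgue_on {s..T}. 0)"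
    by (rule integral_dominated_convergence[OF _ _
          finite_measure.integrable_const[OF finite_measure_lebesgue_on_Icc] lim' bound])
      (intro borel_measurable_const borel_measurable_abs borel_measurable_diff \<psi>m g'm)+
  then have "\<forall>\<^sub>F n in sequentially. (LINT t|lebesgue_on {s..T}. \<bar>\<psi> t - g' n t\<bar>) < \<epsilon>"
    using \<open>\<epsilon> > 0\<close> by (intro order_tendstoD(2)) auto
  then obtain n where "(LINT t|lebesgue_on {s..T}. \<bar>\<psi> t - g' n t\<bar>) < \<epsilon>"
    using eventually_happens'[OF sequentially_bot] by blast
  with g' show thesis by (rule that)
qed


text \<open>Compare \<psi> with a continuous g close to it in L^1. Averaging does not increase the
  L^1 distance, and for g the means converge uniformly by uniform continuity.\<close>

lemma steklov_tendsto:
  fixes \<psi> :: "real \<Rightarrow> real"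
  assumes \<psi>: "ess_bounded \<psi>" and s: "0 \<le> s" "s < T"
  shows "((\<lambda>h. LINT t|lebesgue_on {s+h..T}. \<bar>(LINT x|lebesgue_on {t-h..t}. \<psi> x) / h - \<psi> t\<bar>) \<longlongrightarrow> 0)
    (at_right 0)"
proof (rule tendstoI)
  fix e :: real assume "e > 0"
  obtain g where g: "continuous_on UNIV g" and small: "(LINT t|lebesgue_on {s..T}. \<bar>\<psi> t - g t\<bar>) < e / 4"
    using ess_bounded_approx_continuous[OF \<psi> s(1), of "e / 4" T] \<open>e > 0\<close> by auto
  \<comment> \<open>An oscillation below k on windows integrates to at most e/4 over
    \<open>{s..T}\<close>; the two terms with \<psi> - g contribute e/4 each.\<close>
  define k where "k = e / (4 * (T - s))"
  have "k > 0" using \<open>e > 0\<close> s by (simp add: k_def)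
  have "uniformly_continuous_on {s..T} g"
    by (intro compact_uniformly_continuous continuous_on_subset[OF g]) auto
  then obtain d where d: "d > 0"
    "\<And>x t. x \<in> {s..T} \<Longrightarrow> t \<in> {s..T} \<Longrightarrow> \<bar>x - t\<bar> < d \<Longrightarrow> \<bar>g x - g t\<bar> < k"
    using \<open>k > 0\<close> unfolding uniformly_continuous_on_def dist_real_def by metis
  have i\<psi>: "integrable (lebesgue_on {c..d}) \<psi>" if "s \<le> c" for c d
    using ess_bounded_integrable[OF \<psi>] s that by auto
  have ig: "integrable (lebesgue_on {c..d}) g" for c d
    by (intro continuous_imp_integrable_real continuous_on_subset[OF g]) auto
  have i\<rho>: "integrable (lebesgue_on {c..d}) (\<lambda>t. \<bar>\<psi> t - g t\<bar>)" if "s \<le> c" for c d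
    by (intro integrable_abs Bochner_Integration.integrable_diff i\<psi> ig that)
  have "dist (LINT t|lebesgue_on {s+h..T}. \<bar>(LINT x|lebesgue_on {t-h..t}. \<psi> x) / h - \<psi> t\<bar>) 0 < e"
    if h: "0 < h" "h < min d (T - s)" for h
  proof -
    have pointwise: "\<bar>(LINT x|lebesgue_on {t-h..t}. \<psi> x) / h - \<psi> t\<bar>
        \<le> (LINT x|lebesgue_on {t-h..t}. \<bar>\<psi> x - g x\<bar>) / h + k + \<bar>\<psi> t - g t\<bar>"
      if t: "t \<in> {s+h..T}" for t
    proof -
      have th: "s \<le> t - h" using t by simp
      have "\<bar>(LINT x|lebesgue_on {t-h..t}. \<psi> x - g x)\<bar> \<le> (LINT x|lebesgue_on {t-h..t}. \<bar>\<psi> x - g x\<bar>)"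
        by (rule integral_abs_bound)
      moreover have "(LINT x|lebesgue_on {t-h..t}. \<psi> x - g x)
          = (LINT x|lebesgue_on {t-h..t}. \<psi> x) - (LINT x|lebesgue_on {t-h..t}. g x)"
        by (intro Bochner_Integration.integral_diff i\<psi> ig th)
      moreover have gk: "g x \<le> g t + k" "- g x \<le> - g t + k" if "x \<in> {t-h..t}" for x
        using d(2)[of x t] that t h by auto
      have "(LINT x|lebesgue_on {t-h..t}. g x) \<le> (g t + k) * (t - (t - h))"
        using h gk(1) by (intro integral_lebesgue_on_Icc_bound ig AE_I2) auto
      moreover have "(LINT x|lebesgue_on {t-h..t}. - g x) \<le> (- g t + k) * (t - (t - h))"
        using h gk(2) by (intro integral_lebesgue_on_Icc_bound Bochner_Integration.integrable_minus ig AE_I2) auto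
      ultimately have "\<bar>(LINT x|lebesgue_on {t-h..t}. \<psi> x) - g t * h\<bar>
          \<le> (LINT x|lebesgue_on {t-h..t}. \<bar>\<psi> x - g x\<bar>) + k * h"
        by (simp add: algebra_simps)
      then have "\<bar>(LINT x|lebesgue_on {t-h..t}. \<psi> x) / h - g t\<bar>
          \<le> (LINT x|lebesgue_on {t-h..t}. \<bar>\<psi> x - g x\<bar>) / h + k"
        using h by (simp add: field_simps abs_le_iff)
      then show ?thesis by linarith
    qed
    have iw: "integrable (lebesgue_on {s+h..T}) (\<lambda>t. LINT x|lebesgue_on {t-h..t}. \<psi> x)"
      "integrable (lebesgue_on {s+h..T}) (\<lambda>t. LINT x|lebesgue_on {t-h..t}. \<bar>\<psi> x - g x\<bar>)"
      using h by (intro integrable_window(1) i\<psi> i\<rho>; simp)+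
    have "(LINT t|lebesgue_on {s+h..T}. \<bar>(LINT x|lebesgue_on {t-h..t}. \<psi> x) / h - \<psi> t\<bar>)
        \<le> (LINT t|lebesgue_on {s+h..T}. (LINT x|lebesgue_on {t-h..t}. \<bar>\<psi> x - g x\<bar>) / h + k + \<bar>\<psi> t - g t\<bar>)"
      using h pointwise
      by (intro Bochner_Integration.integral_mono integrable_abs Bochner_Integration.integrable_diff
          Bochner_Integration.integrable_add integrable_divide iw i\<psi> i\<rho>
          finite_measure.integrable_const[OF finite_measure_lebesgue_on_Icc]) auto
    also have "\<dots> = (LINT t|lebesgue_on {s+h..T}. LINT x|lebesgue_on {t-h..t}. \<bar>\<psi> x - g x\<bar>) / h
        + k * (T - (s + h)) + (LINT t|lebesgue_on {s+h..T}. \<bar>\<psi> t - g t\<bar>)"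
      using h iw i\<rho>[of "s+h" T] finite_measure.integrable_const[OF finite_measure_lebesgue_on_Icc, of "s+h" T k]
      by (simp add: Bochner_Integration.integral_add measure_restrict_space)
    also have "\<dots> \<le> e / 4 + e / 4 + e / 4"
    proof (intro add_mono)
      have "(LINT t|lebesgue_on {s+h..T}. LINT x|lebesgue_on {t-h..t}. \<bar>\<psi> x - g x\<bar>)
          \<le> h * (LINT x|lebesgue_on {s..T}. \<bar>\<psi> x - g x\<bar>)"
        using h by (intro integrable_window(2) i\<rho>) auto
      also have "\<dots> \<le> h * (e / 4)" using small h by (intro mult_left_mono) auto
      finally show "(LINT t|lebesgue_on {s+h..T}. LINT x|lebesgue_on {t-h..t}. \<bar>\<psi> x - g x\<bar>) / h \<le> e / 4"
        using h by (simp add: field_simps)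
      have "k * (T - (s + h)) \<le> k * (T - s)" using h \<open>k > 0\<close> by simp
      also have "\<dots> = e / 4" using s by (simp add: k_def field_simps)
      finally show "k * (T - (s + h)) \<le> e / 4" .
      have "0 \<le> (LINT t|lebesgue_on {s..s+h}. \<bar>\<psi> t - g t\<bar>)"
        by (intro Bochner_Integration.integral_nonneg) simp
      moreover have "(LINT t|lebesgue_on {s..T}. \<bar>\<psi> t - g t\<bar>)
          = (LINT t|lebesgue_on {s..s+h}. \<bar>\<psi> t - g t\<bar>) + (LINT t|lebesgue_on {s+h..T}. \<bar>\<psi> t - g t\<bar>)"
        using h by (intro Equivalence_Measurable_On_Borel.integral_combine i\<rho>) auto
      ultimately show "(LINT t|lebesgue_on {s+h..T}. \<bar>\<psi> t - g t\<bar>) \<le> e / 4"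
        using small by linarith
    qed
    finally show ?thesis using \<open>e > 0\<close> by simp
  qed
  then show "\<forall>\<^sub>F h in at_right 0.
      dist (LINT t|lebesgue_on {s+h..T}. \<bar>(LINT x|lebesgue_on {t-h..t}. \<psi> x) / h - \<psi> t\<bar>) 0 < e"
    using d(1) s(2) unfolding eventually_at_right_field by (intro exI[of _ "min d (T - s)"]) auto
qed

section \<open>Functions of time with values in \<open>L\<^sup>2\<close>\<close>

lemma L2_integrable_mult:
  assumes "f \<in> L2 \<Omega>" "g \<in> L2 \<Omega>"
  shows "integrable (lebesgue_on \<Omega>) (\<lambda>x. f x * g x)"
proof (rule Bochner_Integration.integrable_bound)
  show "integrable (lebesgue_on \<Omega>) (\<lambda>x. (f x)\<^sup>2 + (g x)\<^sup>2)"
    using assms by (auto simp: L2_def)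
  show "(\<lambda>x. f x * g x) \<in> borel_measurable (lebesgue_on \<Omega>)"
    using assms by (intro borel_measurable_times) (simp_all add: L2_def)
  have "\<bar>f x * g x\<bar> \<le> (f x)\<^sup>2 + (g x)\<^sup>2" for x
  proof -
    have "2 * (\<bar>f x\<bar> * \<bar>g x\<bar>) \<le> (f x)\<^sup>2 + (g x)\<^sup>2"
      using sum_squares_bound[of "\<bar>f x\<bar>" "\<bar>g x\<bar>"] by (simp add: mult.assoc)
    moreover have "0 \<le> \<bar>f x\<bar> * \<bar>g x\<bar>" by simp
    ultimately show ?thesis unfolding abs_mult by linarith
  qed
  then show "AE x in lebesgue_on \<Omega>. norm (f x * g x) \<le> norm ((f x)\<^sup>2 + (g x)\<^sup>2)"
    by (intro AE_I2) (simp add: order_trans[OF _ abs_ge_self])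
qed

lemma L2_add:
  assumes "f \<in> L2 \<Omega>" "g \<in> L2 \<Omega>"
  shows "(\<lambda>x. f x + g x) \<in> L2 \<Omega>"
proof -
  have "integrable (lebesgue_on \<Omega>) (\<lambda>x. (f x)\<^sup>2 + (g x)\<^sup>2 + 2 * (f x * g x))"
    using assms L2_integrable_mult[OF assms] by (intro Bochner_Integration.integrable_add) (auto simp: L2_def)
  then show ?thesis
    using assms by (auto simp: L2_def power2_sum mult.assoc)
qed

lemma L2_cmult: "f \<in> L2 \<Omega> \<Longrightarrow> (\<lambda>x. c * f x) \<in> L2 \<Omega>"
  by (auto simp: L2_def power_mult_distrib)

lemma L2_zero: "(\<lambda>x. 0) \<in> L2 \<Omega>"
  by (simp add: L2_def)

lemma L2_diff:
  assumes "f \<in> L2 \<Omega>" "g \<in> L2 \<Omega>"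
  shows "(\<lambda>x. f x - g x) \<in> L2 \<Omega>"
  using L2_add[OF assms(1) L2_cmult[OF assms(2), of "-1"]] by simp

lemma L2_inner_commute: "L2_inner \<Omega> f g = L2_inner \<Omega> g f"
  by (simp add: L2_inner_def mult.commute)

lemma L2_inner_diff_left:
  "f \<in> L2 \<Omega> \<Longrightarrow> g \<in> L2 \<Omega> \<Longrightarrow> h \<in> L2 \<Omega> \<Longrightarrow>
    L2_inner \<Omega> (\<lambda>x. f x - g x) h = L2_inner \<Omega> f h - L2_inner \<Omega> g h"
  unfolding L2_inner_def left_diff_distrib
  by (intro Bochner_Integration.integral_diff L2_integrable_mult)

lemma L2_inner_diff_right:
  "f \<in> L2 \<Omega> \<Longrightarrow> g \<in> L2 \<Omega> \<Longrightarrow> h \<in> L2 \<Omega> \<Longrightarrow>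
    L2_inner \<Omega> h (\<lambda>x. f x - g x) = L2_inner \<Omega> h f - L2_inner \<Omega> h g"
  unfolding L2_inner_def right_diff_distrib
  by (intro Bochner_Integration.integral_diff L2_integrable_mult)

lemma L2_inner_self_nonneg: "0 \<le> L2_inner \<Omega> f f"
  unfolding L2_inner_def by (intro Bochner_Integration.integral_nonneg) simp

lemma L2_norm_nonneg: "0 \<le> L2_norm \<Omega> f"
  by (simp add: L2_norm_def L2_inner_self_nonneg)

lemma L2_norm_square: "(L2_norm \<Omega> f)\<^sup>2 = L2_inner \<Omega> f f"
  by (simp add: L2_norm_def L2_inner_self_nonneg)

lemma L2_norm_minus_commute: "L2_norm \<Omega> (\<lambda>x. f x - g x) = L2_norm \<Omega> (\<lambda>x. g x - f x)"
proof -
  have "(f x - g x) * (f x - g x) = (g x - f x) * (g x - f x)" for x by (simp add: algebra_simps)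
  then show ?thesis by (simp add: L2_norm_def L2_inner_def)
qed

lemma L2_inner_Cauchy_Schwarz:
  assumes f: "f \<in> L2 \<Omega>" and g: "g \<in> L2 \<Omega>"
  shows "\<bar>L2_inner \<Omega> f g\<bar> \<le> L2_norm \<Omega> f * L2_norm \<Omega> g"
proof -
  let ?a = "L2_inner \<Omega> f f" and ?b = "L2_inner \<Omega> f g" and ?c = "L2_inner \<Omega> g g"
  \<comment> \<open>Two free coefficients avoid a division: at r = \<open>?c\<close>, t =
    \<open>?b\<close> the form equals \<open>?c * (?a * ?c - ?b\<^sup>2)\<close>.\<close>
  have quad: "0 \<le> r\<^sup>2 * ?a - 2 * r * t * ?b + t\<^sup>2 * ?c" for r t :: real
  proof -
    have "0 \<le> (LINT x|lebesgue_on \<Omega>. (r * f x - t * g x)\<^sup>2)"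
      by (intro Bochner_Integration.integral_nonneg) simp
    also have "\<dots> = (LINT x|lebesgue_on \<Omega>. r\<^sup>2 * (f x * f x) - 2 * r * t * (f x * g x) + t\<^sup>2 * (g x * g x))"
      by (intro Bochner_Integration.integral_cong) (auto simp: power2_eq_square algebra_simps)
    also have "\<dots> = r\<^sup>2 * ?a - 2 * r * t * ?b + t\<^sup>2 * ?c"
      using L2_integrable_mult[OF f f] L2_integrable_mult[OF f g] L2_integrable_mult[OF g g]
      by (simp add: L2_inner_def)
    finally show ?thesis .
  qed
  have "?b\<^sup>2 \<le> ?a * ?c"
  proof (cases "?c = 0")
    case True
    have "?b = 0"
    proof (rule ccontr)
      assume "?b \<noteq> 0"
      then show False
        \<comment> \<open>With \<open>?c = 0\<close> the form is affine in t, and at this t it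
          equals -1.\<close>
        using quad[of 1 "(?a + 1) / (2 * ?b)"] True by simp
    qed
    then show ?thesis using True by simp
  next
    case False
    then have "?c > 0" using L2_inner_self_nonneg[of \<Omega> g] by linarith
    moreover have "0 \<le> ?c * (?a * ?c - ?b\<^sup>2)"
      using quad[of ?c ?b] by (simp add: power2_eq_square algebra_simps)
    ultimately show ?thesis by (simp add: zero_le_mult_iff)
  qed
  then have "\<bar>?b\<bar> \<le> sqrt (?a * ?c)"
    by (simp add: real_le_rsqrt)
  then show ?thesis by (simp add: L2_norm_def real_sqrt_mult)
qed

lemma L2_norm_triangle:
  assumes f: "f \<in> L2 \<Omega>" and g: "g \<in> L2 \<Omega>"
  shows "L2_norm \<Omega> (\<lambda>x. f x + g x) \<le> L2_norm \<Omega> f + L2_norm \<Omega> g"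
proof (rule power2_le_imp_le)
  have "(L2_norm \<Omega> (\<lambda>x. f x + g x))\<^sup>2
      = (LINT x|lebesgue_on \<Omega>. f x * f x + 2 * (f x * g x) + g x * g x)"
    unfolding L2_norm_square L2_inner_def
    by (intro Bochner_Integration.integral_cong) (auto simp: algebra_simps)
  also have "\<dots> = (L2_norm \<Omega> f)\<^sup>2 + 2 * L2_inner \<Omega> f g + (L2_norm \<Omega> g)\<^sup>2"
    using L2_integrable_mult[OF f f] L2_integrable_mult[OF f g] L2_integrable_mult[OF g g]
    by (simp add: L2_norm_square L2_inner_def)
  also have "\<dots> \<le> (L2_norm \<Omega> f + L2_norm \<Omega> g)\<^sup>2"
    using L2_inner_Cauchy_Schwarz[OF f g] by (simp add: power2_sum)
  finally show "(L2_norm \<Omega> (\<lambda>x. f x + g x))\<^sup>2 \<le> (L2_norm \<Omega> f + L2_norm \<Omega> g)\<^sup>2" .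
qed (simp add: L2_norm_nonneg)

lemma L2_norm_diff_triangle:
  assumes "f \<in> L2 \<Omega>" "g \<in> L2 \<Omega>"
  shows "L2_norm \<Omega> f \<le> L2_norm \<Omega> (\<lambda>x. f x - g x) + L2_norm \<Omega> g"
  using L2_norm_triangle[OF L2_diff[OF assms] assms(2)] by simp

lemma L2_norm_diff_le:
  assumes "f \<in> L2 \<Omega>" "g \<in> L2 \<Omega>"
  shows "L2_norm \<Omega> (\<lambda>x. f x - g x) \<le> L2_norm \<Omega> f + L2_norm \<Omega> g"
  using L2_norm_triangle[OF assms(1) L2_cmult[OF assms(2), of "-1"]]
  by (simp add: L2_norm_def L2_inner_def)

lemma L2_inner_tendsto:
  assumes "p \<in> L2 \<Omega>" "q \<in> L2 \<Omega>" "\<And>i. f i \<in> L2 \<Omega>" "\<And>i. g i \<in> L2 \<Omega>"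
    and "((\<lambda>i. L2_norm \<Omega> (\<lambda>x. f i x - p x)) \<longlongrightarrow> 0) A" "((\<lambda>i. L2_norm \<Omega> (\<lambda>x. g i x - q x)) \<longlongrightarrow> 0) A"
  shows "((\<lambda>i. L2_inner \<Omega> (f i) (g i)) \<longlongrightarrow> L2_inner \<Omega> p q) A"
proof -
  let ?d = "\<lambda>i. L2_norm \<Omega> (\<lambda>x. f i x - p x)" and ?e = "\<lambda>i. L2_norm \<Omega> (\<lambda>x. g i x - q x)"
  have le: "norm (L2_inner \<Omega> (f i) (g i) - L2_inner \<Omega> p q)
      \<le> ?d i * ?e i + ?d i * L2_norm \<Omega> q + L2_norm \<Omega> p * ?e i" for i
  proof -
    have "L2_inner \<Omega> (f i) (g i) - L2_inner \<Omega> p q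
      = L2_inner \<Omega> (\<lambda>x. f i x - p x) (\<lambda>x. g i x - q x) + L2_inner \<Omega> (\<lambda>x. f i x - p x) q
        + L2_inner \<Omega> p (\<lambda>x. g i x - q x)"
      using assms(1-4) by (simp add: L2_inner_diff_left L2_inner_diff_right L2_diff)
    then show ?thesis
      using L2_inner_Cauchy_Schwarz[OF L2_diff[OF assms(3,1)] L2_diff[OF assms(4,2)], of i i]
        L2_inner_Cauchy_Schwarz[OF L2_diff[OF assms(3,1)] assms(2), of i]
        L2_inner_Cauchy_Schwarz[OF assms(1) L2_diff[OF assms(4,2)], of i] by simp
  qed
  have "((\<lambda>i. ?d i * ?e i + ?d i * L2_norm \<Omega> q + L2_norm \<Omega> p * ?e i) \<longlongrightarrow> 0 * 0 + 0 * L2_norm \<Omega> q + L2_norm \<Omega> p * 0) A"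
    by (intro tendsto_intros assms(5,6))
  then have "((\<lambda>i. ?d i * ?e i + ?d i * L2_norm \<Omega> q + L2_norm \<Omega> p * ?e i) \<longlongrightarrow> 0) A"
    by simp
  then have "((\<lambda>i. L2_inner \<Omega> (f i) (g i) - L2_inner \<Omega> p q) \<longlongrightarrow> 0) A"
    by (rule Lim_null_comparison[OF always_eventually, rotated]) (intro allI le)
  then show ?thesis by (rule LIM_zero_cancel)
qed

section \<open>Measurability and boundedness in time\<close>

lemma borel_measurable_AE_limit:
  fixes f :: "nat \<Rightarrow> real \<Rightarrow> real"
  assumes f: "\<And>n. f n \<in> borel_measurable (lebesgue_on S)" and S: "S \<in> sets lebesgue"
    and lim: "AE x in lebesgue_on S. (\<lambda>n. f n x) \<longlonglongrightarrow> g x"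
  shows "g \<in> borel_measurable (lebesgue_on S)"
proof -
  obtain N where N: "N \<in> null_sets lebesgue" "\<And>x. x \<notin> N \<Longrightarrow> x \<in> S \<Longrightarrow> (\<lambda>n. f n x) \<longlonglongrightarrow> g x"
    using lim S by (auto simp: AE_restrict_space_iff completion.AE_iff_null_sets)
  have "g measurable_on S"
    by (rule measurable_on_limit[of f S N])
      (use f S N in \<open>auto simp: measurable_on_iff_borel_measurable negligible_iff_null_sets\<close>)
  then show ?thesis using S by (simp add: measurable_on_iff_borel_measurable)
qed

text \<open>The inner product of two simple functions is simple, and continuity of the inner product
  passes this to almost everywhere limits.\<close>

lemma L2_inner_borel_measurable:
  assumes p: "strongly_measurable \<Omega> p" "AE t in lebesgue_on {0<..}. p t \<in> L2 \<Omega>"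
    and q: "strongly_measurable \<Omega> q" "AE t in lebesgue_on {0<..}. q t \<in> L2 \<Omega>"
  shows "(\<lambda>t. L2_inner \<Omega> (p t) (q t)) \<in> borel_measurable (lebesgue_on {0<..})"
proof -
  obtain f where f: "\<And>n. simple_function (lebesgue_on {0<..}) (f n)" "\<And>n t. t > 0 \<Longrightarrow> f n t \<in> L2 \<Omega>"
    "AE t in lebesgue_on {0<..}. (\<lambda>n. L2_norm \<Omega> (\<lambda>x. f n t x - p t x)) \<longlonglongrightarrow> 0"
    using p(1) unfolding strongly_measurable_def by blast
  obtain g where g: "\<And>n. simple_function (lebesgue_on {0<..}) (g n)" "\<And>n t. t > 0 \<Longrightarrow> g n t \<in> L2 \<Omega>"
    "AE t in lebesgue_on {0<..}. (\<lambda>n. L2_norm \<Omega> (\<lambda>x. g n t x - q t x)) \<longlonglongrightarrow> 0"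
    using q(1) unfolding strongly_measurable_def by blast
  show ?thesis
  proof (rule borel_measurable_AE_limit)
    show "(\<lambda>t. L2_inner \<Omega> (f n t) (g n t)) \<in> borel_measurable (lebesgue_on {0<..})" for n
      by (rule borel_measurable_simple_function, rule simple_function_compose2[OF f(1) g(1)])
    have "AE t in lebesgue_on {0<..}. t > (0::real)"
      by (rule AE_I2) simp
    then show "AE t in lebesgue_on {0<..}. (\<lambda>n. L2_inner \<Omega> (f n t) (g n t)) \<longlonglongrightarrow> L2_inner \<Omega> (p t) (q t)"
      using p(2) q(2) f(3) g(3)
      by eventually_elim (intro L2_inner_tendsto f(2) g(2))
  qed simp
qed

lemma Linf_timeE:
  assumes "p \<in> Linf_time \<Omega>"
  obtains C where "C \<ge> 0" "AE t in lebesgue_on {0<..}. p t \<in> L2 \<Omega> \<and> L2_norm \<Omega> (p t) \<le> C"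
proof -
  obtain C where "AE t in lebesgue_on {0<..}. L2_norm \<Omega> (p t) \<le> C"
    using assms by (auto simp: Linf_time_def)
  moreover have "AE t in lebesgue_on {0<..}. p t \<in> L2 \<Omega>"
    using assms by (simp add: Linf_time_def)
  ultimately have "AE t in lebesgue_on {0<..}. p t \<in> L2 \<Omega> \<and> L2_norm \<Omega> (p t) \<le> max C 0"
    by eventually_elim simp
  then show thesis by (intro that[of "max C 0"]) auto
qed

lemma Linf_time_inner:
  assumes p: "p \<in> Linf_time \<Omega>" and q: "q \<in> Linf_time \<Omega>"
  shows "ess_bounded (\<lambda>t. L2_inner \<Omega> (p t) (q t))"
proof -
  obtain C where C: "C \<ge> 0" "AE t in lebesgue_on {0<..}. p t \<in> L2 \<Omega> \<and> L2_norm \<Omega> (p t) \<le> C"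
    using p by (rule Linf_timeE)
  obtain D where D: "D \<ge> 0" "AE t in lebesgue_on {0<..}. q t \<in> L2 \<Omega> \<and> L2_norm \<Omega> (q t) \<le> D"
    using q by (rule Linf_timeE)
  have "AE t in lebesgue_on {0<..}. \<bar>L2_inner \<Omega> (p t) (q t)\<bar> \<le> C * D"
    using C(2) D(2)
  proof eventually_elim
    case (elim t)
    have "\<bar>L2_inner \<Omega> (p t) (q t)\<bar> \<le> L2_norm \<Omega> (p t) * L2_norm \<Omega> (q t)"
      using elim by (intro L2_inner_Cauchy_Schwarz) auto
    also have "\<dots> \<le> C * D" using elim C by (intro mult_mono) (auto simp: L2_norm_nonneg)
    finally show ?case .
  qed
  moreover have "(\<lambda>t. L2_inner \<Omega> (p t) (q t)) \<in> borel_measurable (lebesgue_on {0<..})"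
    using p q by (intro L2_inner_borel_measurable) (auto simp: Linf_time_def)
  ultimately show ?thesis by (auto simp: ess_bounded_def)
qed

lemma Linf_time_norm:
  assumes p: "p \<in> Linf_time \<Omega>"
  shows "ess_bounded (\<lambda>t. L2_norm \<Omega> (p t))"
proof -
  obtain C where C: "C \<ge> 0" "AE t in lebesgue_on {0<..}. p t \<in> L2 \<Omega> \<and> L2_norm \<Omega> (p t) \<le> C"
    using p by (rule Linf_timeE)
  have "AE t in lebesgue_on {0<..}. \<bar>L2_norm \<Omega> (p t)\<bar> \<le> C"
    using C(2) by eventually_elim (simp add: L2_norm_nonneg)
  moreover have "(\<lambda>t. L2_norm \<Omega> (p t)) \<in> borel_measurable (lebesgue_on {0<..})"
    using Linf_time_inner[OF p p] unfolding L2_norm_def ess_bounded_def by auto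
  ultimately show ?thesis by (auto simp: ess_bounded_def)
qed

lemma Linf_time_diff:
  assumes p: "p \<in> Linf_time \<Omega>" and q: "q \<in> Linf_time \<Omega>"
  shows "(\<lambda>t x. p t x - q t x) \<in> Linf_time \<Omega>"
proof -
  obtain C where C: "C \<ge> 0" "AE t in lebesgue_on {0<..}. p t \<in> L2 \<Omega> \<and> L2_norm \<Omega> (p t) \<le> C"
    using p by (rule Linf_timeE)
  obtain D where D: "D \<ge> 0" "AE t in lebesgue_on {0<..}. q t \<in> L2 \<Omega> \<and> L2_norm \<Omega> (q t) \<le> D"
    using q by (rule Linf_timeE)
  obtain f where f: "\<And>n. simple_function (lebesgue_on {0<..}) (f n)" "\<And>n t. t > 0 \<Longrightarrow> f n t \<in> L2 \<Omega>"
    "AE t in lebesgue_on {0<..}. (\<lambda>n. L2_norm \<Omega> (\<lambda>x. f n t x - p t x)) \<longlonglongrightarrow> 0"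
    using p unfolding Linf_time_def strongly_measurable_def by blast
  obtain g where g: "\<And>n. simple_function (lebesgue_on {0<..}) (g n)" "\<And>n t. t > 0 \<Longrightarrow> g n t \<in> L2 \<Omega>"
    "AE t in lebesgue_on {0<..}. (\<lambda>n. L2_norm \<Omega> (\<lambda>x. g n t x - q t x)) \<longlonglongrightarrow> 0"
    using q unfolding Linf_time_def strongly_measurable_def by blast
  have "AE t in lebesgue_on {0<..}. t > (0::real)"
    by (rule AE_I2) simp
  then have "AE t in lebesgue_on {0<..}.
      (\<lambda>n. L2_norm \<Omega> (\<lambda>x. (f n t x - g n t x) - (p t x - q t x))) \<longlonglongrightarrow> 0"
    using C(2) D(2) f(3) g(3)
  proof eventually_elim
    case (elim t)
    show ?case
    proof (rule tendsto_sandwich[OF _ _ tendsto_const])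
      have "L2_norm \<Omega> (\<lambda>x. (f n t x - g n t x) - (p t x - q t x))
          \<le> L2_norm \<Omega> (\<lambda>x. f n t x - p t x) + L2_norm \<Omega> (\<lambda>x. g n t x - q t x)" for n
        using L2_norm_diff_le[OF L2_diff[of "f n t" \<Omega> "p t"] L2_diff[of "g n t" \<Omega> "q t"]] elim f(2) g(2)
        by (simp add: algebra_simps)
      then show "\<forall>\<^sub>F n in sequentially. L2_norm \<Omega> (\<lambda>x. (f n t x - g n t x) - (p t x - q t x))
          \<le> L2_norm \<Omega> (\<lambda>x. f n t x - p t x) + L2_norm \<Omega> (\<lambda>x. g n t x - q t x)"
        by simp
      show "(\<lambda>n. L2_norm \<Omega> (\<lambda>x. f n t x - p t x) + L2_norm \<Omega> (\<lambda>x. g n t x - q t x)) \<longlonglongrightarrow> 0"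
        using tendsto_add[OF elim(4,5)] by simp
    qed (simp add: L2_norm_nonneg)
  qed
  moreover have "simple_function (lebesgue_on {0<..}) (\<lambda>t x. f n t x - g n t x)" for n
    by (rule simple_function_compose2[OF f(1) g(1), of "\<lambda>a b x. a x - b x"])
  ultimately have "strongly_measurable \<Omega> (\<lambda>t x. p t x - q t x)"
    unfolding strongly_measurable_def using f(2) g(2)
    by (intro exI[of _ "\<lambda>n t x. f n t x - g n t x"]) (auto intro: L2_diff)
  moreover have "AE t in lebesgue_on {0<..}. L2_norm \<Omega> (\<lambda>x. p t x - q t x) \<le> C + D"
    using C(2) D(2)
  proof eventually_elim
    case (elim t)
    then show ?case using L2_norm_diff_le[of "p t" \<Omega> "q t"] by linarith
  qed
  moreover have "AE t in lebesgue_on {0<..}. (\<lambda>x. p t x - q t x) \<in> L2 \<Omega>"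
    using C(2) D(2) by eventually_elim (auto intro: L2_diff)
  ultimately show ?thesis by (auto simp: Linf_time_def)
qed

lemma strongly_measurable_simple:
  assumes "simple_function (lebesgue_on {0<..}) S" "\<And>t. t > 0 \<Longrightarrow> S t \<in> L2 \<Omega>"
  shows "strongly_measurable \<Omega> S"
  unfolding strongly_measurable_def
  by (rule exI[of _ "\<lambda>n. S"]) (use assms in \<open>auto simp: L2_norm_def L2_inner_def\<close>)

lemma Linf_time_simple:
  assumes S: "simple_function (lebesgue_on {0<..}) S" "\<And>t. t > 0 \<Longrightarrow> S t \<in> L2 \<Omega>"
  shows "S \<in> Linf_time \<Omega>"
proof -
  have "finite ((\<lambda>t. L2_norm \<Omega> (S t)) ` {0<..})"
    using simple_functionD(1)[OF simple_function_compose1[OF S(1), of "L2_norm \<Omega>"]] by simp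
  then have "L2_norm \<Omega> (S t) \<le> Max ((\<lambda>t. L2_norm \<Omega> (S t)) ` {0<..})" if "t > 0" for t
    using that by (intro Max_ge) auto
  then show ?thesis
    using strongly_measurable_simple[OF S] S(2) unfolding Linf_time_def
    by (auto intro!: AE_I2 exI)
qed

lemma Linf_time_const: "h \<in> L2 \<Omega> \<Longrightarrow> (\<lambda>t. h) \<in> Linf_time \<Omega>"
  by (intro Linf_time_simple) auto

lemma Linf_time_approx_simple:
  assumes F: "F \<in> Linf_time \<Omega>" and s: "0 \<le> s" and "\<epsilon> > 0"
  obtains S where "simple_function (lebesgue_on {0<..}) S" "\<And>t. t > 0 \<Longrightarrow> S t \<in> L2 \<Omega>"
    "(LINT t|lebesgue_on {s..T}. L2_norm \<Omega> (\<lambda>x. F t x - S t x)) < \<epsilon>"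
proof -
  obtain C where C: "C \<ge> 0" "AE t in lebesgue_on {0<..}. F t \<in> L2 \<Omega> \<and> L2_norm \<Omega> (F t) \<le> C"
    using F by (rule Linf_timeE)
  obtain f where f: "\<And>n. simple_function (lebesgue_on {0<..}) (f n)" "\<And>n t. t > 0 \<Longrightarrow> f n t \<in> L2 \<Omega>"
    "AE t in lebesgue_on {0<..}. (\<lambda>n. L2_norm \<Omega> (\<lambda>x. f n t x - F t x)) \<longlonglongrightarrow> 0"
    using F unfolding Linf_time_def strongly_measurable_def by blast
  \<comment> \<open>The simple approximants of F need not be bounded uniformly in n. Values of norm
    above C + 1 are replaced by 0: this keeps them simple and dominated, and leaves the limit alone
    because an approximant within distance 1 of \<open>F t\<close> has norm at most C + 1.\<close>
  define c where "c g = (if L2_norm \<Omega> g \<le> C + 1 then g else (\<lambda>x. 0))" for g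
  have cL2: "c g \<in> L2 \<Omega>" if "g \<in> L2 \<Omega>" for g
    using that by (simp add: c_def L2_zero)
  have cle: "L2_norm \<Omega> (c g) \<le> C + 1" for g
    using C by (simp add: c_def L2_norm_def L2_inner_def)
  have simple: "simple_function (lebesgue_on {0<..}) (\<lambda>t. c (f n t))" for n
    by (rule simple_function_compose1[OF f(1)])
  have pos: "AE t in lebesgue_on {0<..}. t > (0::real)"
    by (rule AE_I2) simp
  have lim: "AE t in lebesgue_on {0<..}. (\<lambda>n. L2_norm \<Omega> (\<lambda>x. F t x - c (f n t) x)) \<longlonglongrightarrow> 0"
    using C(2) f(3) pos
  proof eventually_elim
    case (elim t)
    have "\<forall>\<^sub>F n in sequentially. L2_norm \<Omega> (\<lambda>x. f n t x - F t x) < 1"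
      by (rule order_tendstoD(2)[OF elim(2)]) simp
    then have "\<forall>\<^sub>F n in sequentially. L2_norm \<Omega> (\<lambda>x. f n t x - F t x) = L2_norm \<Omega> (\<lambda>x. F t x - c (f n t) x)"
    proof eventually_elim
      case (elim n)
      have "L2_norm \<Omega> (f n t) \<le> C + 1"
        using L2_norm_diff_triangle[of "f n t" \<Omega> "F t"] elim \<open>F t \<in> L2 \<Omega> \<and> _\<close> f(2)[OF \<open>t > 0\<close>, of n]
        by linarith
      then show ?case by (simp add: c_def L2_norm_minus_commute)
    qed
    then show ?case using elim(2) by (rule Lim_transform_eventually[rotated])
  qed
  have bound: "AE t in lebesgue_on {0<..}. norm (L2_norm \<Omega> (\<lambda>x. F t x - c (f n t) x)) \<le> 2 * C + 1" for n
    using C(2) pos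
  proof eventually_elim
    case (elim t)
    then show ?case
      using L2_norm_diff_le[of "F t" \<Omega> "c (f n t)"] cL2 f(2) cle[of "f n t"]
      by (fastforce simp: L2_norm_nonneg)
  qed
  have meas: "(\<lambda>t. L2_norm \<Omega> (\<lambda>x. F t x - c (f n t) x)) \<in> borel_measurable (lebesgue_on {s..T})" for n
    using Linf_time_norm[OF Linf_time_diff[OF F Linf_time_simple[OF simple]]] cL2 f(2) s
    by (intro borel_measurable_lebesgue_on_Icc) (auto simp: ess_bounded_def)
  have "(\<lambda>n. LINT t|lebesgue_on {s..T}. L2_norm \<Omega> (\<lambda>x. F t x - c (f n t) x)) \<longlonglongrightarrow> (LINT t|lebesgue_on {s..T}. 0)"
    by (rule integral_dominated_convergence[OF _ meas
          finite_measure.integrable_const[OF finite_measure_lebesgue_on_Icc]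
          AE_lebesgue_on_Icc[OF lim s] AE_lebesgue_on_Icc[OF bound s]]) simp
  then have "\<forall>\<^sub>F n in sequentially. (LINT t|lebesgue_on {s..T}. L2_norm \<Omega> (\<lambda>x. F t x - c (f n t) x)) < \<epsilon>"
    using \<open>\<epsilon> > 0\<close> by (intro order_tendstoD(2)) simp_all
  then obtain n where "(LINT t|lebesgue_on {s..T}. L2_norm \<Omega> (\<lambda>x. F t x - c (f n t) x)) < \<epsilon>"
    using eventually_happens'[OF sequentially_bot] by blast
  with simple show thesis
    using cL2 f(2) by (intro that[of "\<lambda>t. c (f n t)"]) auto
qed

section \<open>The energy inequality\<close>

text \<open>The increment is known only through its pairings with fixed elements. Pairing it with
  itself gives \<parallel>d\<parallel>^2 \<le> \<parallel>d\<parallel> \<integral>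
  \<parallel>F\<parallel>, and one factor cancels.\<close>

lemma L2_norm_increment_le:
  assumes F: "F \<in> Linf_time \<Omega>" and d: "d \<in> L2 \<Omega>" and p: "0 \<le> p"
    and FTC: "L2_inner \<Omega> d d = (LINT t|lebesgue_on {p..q}. L2_inner \<Omega> (F t) d)"
  shows "L2_norm \<Omega> d \<le> (LINT t|lebesgue_on {p..q}. L2_norm \<Omega> (F t))"
proof -
  have "AE t in lebesgue_on {0<..}. F t \<in> L2 \<Omega>"
    using F by (simp add: Linf_time_def)
  then have "AE t in lebesgue_on {p..q}. F t \<in> L2 \<Omega>"
    using p by (rule AE_lebesgue_on_Icc)
  then have le: "AE t in lebesgue_on {p..q}. L2_inner \<Omega> (F t) d \<le> L2_norm \<Omega> (F t) * L2_norm \<Omega> d"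
    by eventually_elim (use L2_inner_Cauchy_Schwarz[OF _ d] in \<open>auto simp: abs_le_iff\<close>)
  have "L2_norm \<Omega> d * L2_norm \<Omega> d = (LINT t|lebesgue_on {p..q}. L2_inner \<Omega> (F t) d)"
    using FTC by (simp add: L2_norm_square flip: power2_eq_square)
  also have "\<dots> \<le> (LINT t|lebesgue_on {p..q}. L2_norm \<Omega> (F t) * L2_norm \<Omega> d)"
    by (intro integral_mono_AE le integrable_mult_left ess_bounded_integrable[OF _ p]
        Linf_time_inner Linf_time_norm F Linf_time_const d)
  also have "\<dots> = (LINT t|lebesgue_on {p..q}. L2_norm \<Omega> (F t)) * L2_norm \<Omega> d"
    by simp
  finally have "L2_norm \<Omega> d * L2_norm \<Omega> d \<le> (LINT t|lebesgue_on {p..q}. L2_norm \<Omega> (F t)) * L2_norm \<Omega> d" .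
  moreover have "0 \<le> (LINT t|lebesgue_on {p..q}. L2_norm \<Omega> (F t))"
    by (intro Bochner_Integration.integral_nonneg L2_norm_nonneg)
  ultimately show ?thesis
    using L2_norm_nonneg[of \<Omega> d] by (cases "L2_norm \<Omega> d = 0") auto
qed

lemma ess_bounded_indicator_simple:
  assumes "simple_function (lebesgue_on {0<..}) S"
  shows "ess_bounded (\<lambda>t. of_bool (S t = g))"
proof -
  have "simple_function (lebesgue_on {0<..}) (\<lambda>t. of_bool (S t = g) :: real)"
    by (rule simple_function_compose1[OF assms])
  then have "(\<lambda>t. of_bool (S t = g) :: real) \<in> borel_measurable (lebesgue_on {0<..})"
    by (rule borel_measurable_simple_function)
  then show ?thesis
    unfolding ess_bounded_def by (auto intro!: exI[of _ 1])
qed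

text \<open>The energy \<open>E t = (b t, z t)\<close> satisfies \<open>E t - E (t - h) \<le> 2 (b t, z t - z (t - h))\<close>. After
  integration in \<open>t\<close> and division by \<open>h\<close>, the right-hand side contains a Steklov mean of \<open>F\<close>; as \<open>F\<close>
  is approximated by simple functions, its convergence reduces to that of real functions, so that
  no continuity of \<open>b\<close> in time is needed.\<close>

lemma integral_energy_derivative_nonneg:
  fixes b F z :: "real \<Rightarrow> 'a::euclidean_space \<Rightarrow> real"
  assumes b: "b \<in> Linf_time \<Omega>" and F: "F \<in> Linf_time \<Omega>" and z: "z \<in> Linf_time \<Omega>"
    and bL2: "\<And>t. 0 \<le> t \<Longrightarrow> b t \<in> L2 \<Omega>" and zL2: "\<And>t. 0 \<le> t \<Longrightarrow> z t \<in> L2 \<Omega>"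
    and FTC: "\<And>h p q. h \<in> L2 \<Omega> \<Longrightarrow> 0 \<le> p \<Longrightarrow> p \<le> q \<Longrightarrow>
      L2_inner \<Omega> (\<lambda>x. z q x - z p x) h = (LINT t|lebesgue_on {p..q}. L2_inner \<Omega> (F t) h)"
    and psd: "\<And>p q. 0 \<le> p \<Longrightarrow> 0 \<le> q \<Longrightarrow>
      2 * L2_inner \<Omega> (b q) (z p) \<le> L2_inner \<Omega> (b q) (z q) + L2_inner \<Omega> (b p) (z p)"
    and pos: "\<And>t. 0 \<le> t \<Longrightarrow> 0 \<le> L2_inner \<Omega> (b t) (z t)"
    and zs: "L2_norm \<Omega> (z s) = 0" and s: "0 \<le> s" "s < T"
  shows "0 \<le> (LINT t|lebesgue_on {s..T}. L2_inner \<Omega> (b t) (F t))"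
proof -
  obtain Cb where Cb: "Cb \<ge> 0" "AE t in lebesgue_on {0<..}. b t \<in> L2 \<Omega> \<and> L2_norm \<Omega> (b t) \<le> Cb"
    using b by (rule Linf_timeE)
  obtain CF where CF: "CF \<ge> 0" "AE t in lebesgue_on {0<..}. F t \<in> L2 \<Omega> \<and> L2_norm \<Omega> (F t) \<le> CF"
    using F by (rule Linf_timeE)
  let ?E = "\<lambda>t. L2_inner \<Omega> (b t) (z t)" and ?bF = "\<lambda>t. L2_inner \<Omega> (b t) (F t)"
  have iE: "integrable (lebesgue_on {c..d}) ?E" if "0 \<le> c" for c d
    by (rule ess_bounded_integrable[OF Linf_time_inner[OF b z] that])
  have ibF: "integrable (lebesgue_on {c..d}) ?bF" if "0 \<le> c" for c d
    by (rule ess_bounded_integrable[OF Linf_time_inner[OF b F] that])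
  have Lip: "L2_norm \<Omega> (\<lambda>x. z q x - z p x) \<le> CF * (q - p)" if "0 \<le> p" "p \<le> q" for p q
  proof -
    have d: "(\<lambda>x. z q x - z p x) \<in> L2 \<Omega>" using that by (intro L2_diff zL2) auto
    have "L2_norm \<Omega> (\<lambda>x. z q x - z p x) \<le> (LINT t|lebesgue_on {p..q}. L2_norm \<Omega> (F t))"
      using that by (intro L2_norm_increment_le F d FTC) auto
    also have "\<dots> \<le> CF * (q - p)"
      using AE_lebesgue_on_Icc[OF CF(2) \<open>0 \<le> p\<close>] that
      by (intro integral_lebesgue_on_Icc_bound ess_bounded_integrable Linf_time_norm F) auto
    finally show ?thesis .
  qed
  \<comment> \<open>As z vanishes at s and is Lipschitz in time, the energy is O(h) on this window
    and its integral O(h^2), which disappears after division by h.\<close>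
  have small_s: "(LINT t|lebesgue_on {s..s+h}. ?E t) \<le> Cb * CF * h * h" if "0 \<le> h" for h
  proof -
    have "AE t in lebesgue_on {s..s+h}. ?E t \<le> Cb * CF * h"
      using AE_lebesgue_on_Icc[OF Cb(2) s(1)] AE_space
    proof eventually_elim
      case (elim t)
      then have t: "0 \<le> t" "s \<le> t" "t \<le> s + h" using s by auto
      have "L2_norm \<Omega> (z t) \<le> CF * (t - s)"
        using L2_norm_diff_triangle[OF zL2[OF t(1)] zL2[OF s(1)]] Lip[OF s(1) t(2)] zs by linarith
      also have "\<dots> \<le> CF * h" using t CF by (intro mult_left_mono) auto
      finally have "L2_norm \<Omega> (b t) * L2_norm \<Omega> (z t) \<le> Cb * (CF * h)"
        using elim Cb by (intro mult_mono) (auto simp: L2_norm_nonneg)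
      then show ?case
        using L2_inner_Cauchy_Schwarz[OF bL2[OF t(1)] zL2[OF t(1)]] by simp
    qed
    from integral_lebesgue_on_Icc_bound[OF iE[OF s(1)] this] that show ?thesis by simp
  qed
  have key: "0 \<le> (LINT t|lebesgue_on {s..T}. ?bF t) + 2 * Cb * \<epsilon>" if \<epsilon>: "\<epsilon> > 0" for \<epsilon>
  proof -
    obtain S where S: "simple_function (lebesgue_on {0<..}) S" "\<And>t. t > 0 \<Longrightarrow> S t \<in> L2 \<Omega>"
      and S\<epsilon>: "(LINT t|lebesgue_on {s..T}. L2_norm \<Omega> (\<lambda>x. F t x - S t x)) < \<epsilon>"
      using Linf_time_approx_simple[OF F s(1) \<epsilon>] by blast
    define V where "V = S ` {0<..}"
    have V: "finite V" "\<And>g. g \<in> V \<Longrightarrow> g \<in> L2 \<Omega>"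
      using simple_functionD(1)[OF S(1)] S(2) by (auto simp: V_def)
    \<comment> \<open>S is the finite sum of its values g times the indicators
      \<open>\<kappa> g\<close> of its level sets; its Steklov means thus involve only real
      functions, with coefficients (g, b t) bounded by
      \<open>Cb * L2_norm \<Omega> g\<close>.\<close>
    define \<kappa> where "\<kappa> g t = (of_bool (S t = g) :: real)" for g t
    define \<rho> where "\<rho> t = L2_norm \<Omega> (\<lambda>x. F t x - S t x)" for t
    have \<kappa>: "ess_bounded (\<kappa> g)" for g
      using ess_bounded_indicator_simple[OF S(1)] by (simp add: \<kappa>_def[abs_def])
    have \<rho>: "ess_bounded \<rho>"
      using Linf_time_norm[OF Linf_time_diff[OF F Linf_time_simple[OF S]]] by (simp add: \<rho>_def[abs_def])
    have S_expand: "L2_inner \<Omega> (S t) h = (\<Sum>g\<in>V. L2_inner \<Omega> g h * \<kappa> g t)" if "t > 0" for t h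
      using V(1) that by (simp add: \<kappa>_def V_def if_distrib sum.delta' of_bool_def cong: if_cong)
    define D where "D q h t = \<bar>(LINT x|lebesgue_on {t-h..t}. q x) / h - q t\<bar>" for q :: "real \<Rightarrow> real" and h t
    define J where "J q h = (LINT t|lebesgue_on {s+h..T}. D q h t)" for q h
    have iD: "integrable (lebesgue_on {s+h..T}) (D q h)"
      if "ess_bounded q" "0 < h" "s + h \<le> T" for q h
      unfolding D_def using that s
      by (intro integrable_abs Bochner_Integration.integrable_diff integrable_divide integrable_window(1)
          ess_bounded_integrable) auto
    have J: "((\<lambda>h. J q h) \<longlongrightarrow> 0) (at_right 0)" if "ess_bounded q" for q
      unfolding J_def D_def by (rule steklov_tendsto[OF that s])
    \<comment> \<open>The last term covers half of \<open>Cb * CF * h\<close> from the initial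
      window and all of it from enlarging \<open>{s+h..T}\<close> to \<open>{s..T}\<close>.\<close>
    define R where "R h = (\<Sum>g\<in>V. Cb * L2_norm \<Omega> g * J (\<kappa> g) h) + Cb * J \<rho> h + 2 * (Cb * CF * h)" for h
    have main: "0 \<le> (LINT t|lebesgue_on {s..T}. ?bF t) + 2 * Cb * \<epsilon> + R h" if h: "0 < h" "s + h < T" for h
    proof -
      \<comment> \<open>The term with \<rho> is paid twice: F becomes S under the window integral,
        and S becomes F again at time t. The terms with \<open>D\<close> are the errors of replacing
        window means by values at t.\<close>
      define K where "K t = ?bF t + 2 * Cb * \<rho> t + (\<Sum>g\<in>V. Cb * L2_norm \<Omega> g * D (\<kappa> g) h t) + Cb * D \<rho> h t" for t
      have pointwise: "AE t in lebesgue_on {s+h..T}. ?E t - ?E (t - h) \<le> 2 * h * K t"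
      proof -
        have sh: "0 \<le> s + h" using s h by simp
        show ?thesis
          using AE_lebesgue_on_Icc[OF Cb(2) sh] AE_lebesgue_on_Icc[OF CF(2) sh] AE_space
        proof eventually_elim
          case (elim t)
          then have t: "0 \<le> t - h" "0 \<le> t" "0 < t" "t - h \<le> t" "t \<le> T" using s h by auto
          have bt: "b t \<in> L2 \<Omega>" by (rule bL2[OF t(2)])
          have CSb: "L2_inner \<Omega> g (b t) \<le> Cb * L2_norm \<Omega> g" "- L2_inner \<Omega> g (b t) \<le> Cb * L2_norm \<Omega> g"
            if "g \<in> L2 \<Omega>" for g
          proof -
            have "L2_norm \<Omega> g * L2_norm \<Omega> (b t) \<le> L2_norm \<Omega> g * Cb"
              using elim by (intro mult_left_mono L2_norm_nonneg) auto
            then show "L2_inner \<Omega> g (b t) \<le> Cb * L2_norm \<Omega> g" "- L2_inner \<Omega> g (b t) \<le> Cb * L2_norm \<Omega> g"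
              using L2_inner_Cauchy_Schwarz[OF that bt] by (auto simp: mult.commute)
          qed
          have "?E t - ?E (t - h) \<le> 2 * L2_inner \<Omega> (b t) (\<lambda>x. z t x - z (t - h) x)"
            using psd[OF t(1,2)] L2_inner_diff_right[OF zL2[OF t(2)] zL2[OF t(1)] bt] by simp
          \<comment> \<open>Here \<open>b t\<close> is frozen and serves as the fixed test element,
            so only F varies under the integral.\<close>
          also have "L2_inner \<Omega> (b t) (\<lambda>x. z t x - z (t - h) x)
              = (LINT x|lebesgue_on {t-h..t}. L2_inner \<Omega> (F x) (b t))"
            using FTC[OF bt t(1,4)] by (simp add: L2_inner_commute)
          also have "\<dots> \<le> (LINT x|lebesgue_on {t-h..t}. (\<Sum>g\<in>V. L2_inner \<Omega> g (b t) * \<kappa> g x) + Cb * \<rho> x)"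
          proof (rule integral_mono_AE)
            show "integrable (lebesgue_on {t-h..t}) (\<lambda>x. L2_inner \<Omega> (F x) (b t))"
              by (intro ess_bounded_integrable Linf_time_inner F Linf_time_const bt t)
            show "integrable (lebesgue_on {t-h..t}) (\<lambda>x. (\<Sum>g\<in>V. L2_inner \<Omega> g (b t) * \<kappa> g x) + Cb * \<rho> x)"
              by (intro Bochner_Integration.integrable_add Bochner_Integration.integrable_sum
                  integrable_mult_right ess_bounded_integrable \<kappa> \<rho> t)
            have "AE x in lebesgue_on {0<..}. x > (0::real)" by (rule AE_I2) simp
            from AE_lebesgue_on_Icc[OF this t(1)] AE_lebesgue_on_Icc[OF CF(2) t(1)]
            show "AE x in lebesgue_on {t-h..t}. L2_inner \<Omega> (F x) (b t)
                \<le> (\<Sum>g\<in>V. L2_inner \<Omega> g (b t) * \<kappa> g x) + Cb * \<rho> x"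
            proof eventually_elim
              case (elim x)
              have "L2_inner \<Omega> (F x) (b t) - L2_inner \<Omega> (S x) (b t) \<le> Cb * \<rho> x"
                using CSb(1)[OF L2_diff[of "F x" \<Omega> "S x"]] elim S(2)[of x]
                  L2_inner_diff_left[of "F x" \<Omega> "S x" "b t"] bt by (simp add: \<rho>_def)
              then show ?case
                using S_expand[OF elim(1), of "b t"] by linarith
            qed
          qed
          also have "\<dots> = (\<Sum>g\<in>V. L2_inner \<Omega> g (b t) * (LINT x|lebesgue_on {t-h..t}. \<kappa> g x))
              + Cb * (LINT x|lebesgue_on {t-h..t}. \<rho> x)"
            using ess_bounded_integrable[OF \<kappa> t(1)] ess_bounded_integrable[OF \<rho> t(1)]
            by (simp add: Bochner_Integration.integral_add Bochner_Integration.integral_sum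
                Bochner_Integration.integrable_sum)
          also have "\<dots> \<le> (\<Sum>g\<in>V. h * (L2_inner \<Omega> g (b t) * \<kappa> g t) + h * (Cb * L2_norm \<Omega> g * D (\<kappa> g) h t))
              + h * (Cb * \<rho> t + Cb * D \<rho> h t)"
          proof (intro add_mono sum_mono)
            have mean: "(LINT x|lebesgue_on {t-h..t}. q x) = h * (q t + ((LINT x|lebesgue_on {t-h..t}. q x) / h - q t))"
              for q using h by (simp add: field_simps)
            {
              fix g assume "g \<in> V"
              let ?d = "(LINT x|lebesgue_on {t-h..t}. \<kappa> g x) / h - \<kappa> g t"
              have "L2_inner \<Omega> g (b t) * ?d \<le> \<bar>L2_inner \<Omega> g (b t)\<bar> * \<bar>?d\<bar>"
                by (metis abs_ge_self abs_mult)
              also have "\<dots> \<le> Cb * L2_norm \<Omega> g * D (\<kappa> g) h t"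
                unfolding D_def using CSb[OF V(2)[OF \<open>g \<in> V\<close>]] by (intro mult_right_mono) auto
              finally have "h * (L2_inner \<Omega> g (b t) * ?d) \<le> h * (Cb * L2_norm \<Omega> g * D (\<kappa> g) h t)"
                using h by (intro mult_left_mono) auto
              moreover have "L2_inner \<Omega> g (b t) * (LINT x|lebesgue_on {t-h..t}. \<kappa> g x)
                  = h * (L2_inner \<Omega> g (b t) * \<kappa> g t) + h * (L2_inner \<Omega> g (b t) * ?d)"
                by (subst mean) (simp only: algebra_simps)
              ultimately show "L2_inner \<Omega> g (b t) * (LINT x|lebesgue_on {t-h..t}. \<kappa> g x)
                  \<le> h * (L2_inner \<Omega> g (b t) * \<kappa> g t) + h * (Cb * L2_norm \<Omega> g * D (\<kappa> g) h t)"
                by linarith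
            }
            let ?d = "(LINT x|lebesgue_on {t-h..t}. \<rho> x) / h - \<rho> t"
            have "Cb * ?d \<le> Cb * D \<rho> h t"
              unfolding D_def using Cb(1) by (intro mult_left_mono) auto
            then have "h * (Cb * ?d) \<le> h * (Cb * D \<rho> h t)"
              by (rule mult_left_mono) (use h in simp)
            moreover have "Cb * (LINT x|lebesgue_on {t-h..t}. \<rho> x) = h * (Cb * \<rho> t) + h * (Cb * ?d)"
              by (subst mean) (simp only: algebra_simps)
            ultimately show "Cb * (LINT x|lebesgue_on {t-h..t}. \<rho> x) \<le> h * (Cb * \<rho> t + Cb * D \<rho> h t)"
              by (simp only: distrib_left)
          qed
          also have "\<dots> = h * (L2_inner \<Omega> (S t) (b t) + (\<Sum>g\<in>V. Cb * L2_norm \<Omega> g * D (\<kappa> g) h t)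
              + Cb * \<rho> t + Cb * D \<rho> h t)"
            unfolding S_expand[OF t(3)] by (simp only: sum.distrib distrib_left sum_distrib_left add.assoc)
          also have "\<dots> \<le> h * K t"
          proof -
            have "L2_inner \<Omega> (S t) (b t) - L2_inner \<Omega> (F t) (b t) \<le> Cb * \<rho> t"
              using CSb(2)[OF L2_diff[of "F t" \<Omega> "S t"]] elim S(2)[OF t(3)]
                L2_inner_diff_left[of "F t" \<Omega> "S t" "b t"] bt by (simp add: \<rho>_def)
            then show ?thesis
              using h unfolding K_def by (intro mult_left_mono) (auto simp: L2_inner_commute)
          qed
          finally show ?case by simp
        qed
      qed
      have "0 \<le> s + h" using s h by simp
      then have ibF': "integrable (lebesgue_on {s+h..T}) ?bF" and i\<rho>': "integrable (lebesgue_on {s+h..T}) \<rho>"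
        by (rule ibF, rule ess_bounded_integrable[OF \<rho>])
      have iD': "integrable (lebesgue_on {s+h..T}) (D (\<kappa> g) h)" "integrable (lebesgue_on {s+h..T}) (D \<rho> h)" for g
        using h by (auto intro!: iD \<kappa> \<rho>)
      have iK: "integrable (lebesgue_on {s+h..T}) K"
        unfolding K_def
        by (intro Bochner_Integration.integrable_add Bochner_Integration.integrable_sum integrable_mult_right
            ibF' i\<rho>' iD')
      \<comment> \<open>The final window enters with a favourable sign by \<open>pos\<close>, the
        initial one is of order h^2.\<close>
      have "- (Cb * CF * h * h) \<le> - (LINT t|lebesgue_on {s..s+h}. ?E t)"
        using small_s[of h] h by simp
      also have "\<dots> \<le> (LINT t|lebesgue_on {T-h..T}. ?E t) - (LINT t|lebesgue_on {s..s+h}. ?E t)"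
      proof -
        have "0 \<le> (LINT t|lebesgue_on {T-h..T}. ?E t)"
          using h s by (intro integral_nonneg_AE AE_I2 pos) auto
        then show ?thesis by simp
      qed
      also have "\<dots> = (LINT t|lebesgue_on {s+h..T}. ?E t - ?E (t - h))"
        using integral_backward_difference(2)[OF iE[OF s(1)], of h T] h by simp
      also have "\<dots> \<le> (LINT t|lebesgue_on {s+h..T}. 2 * h * K t)"
        using h by (intro integral_mono_AE pointwise integral_backward_difference(1)
            integrable_mult_right iK iE s) auto
      also have "\<dots> = 2 * h * (LINT t|lebesgue_on {s+h..T}. K t)" by simp
      finally have "0 \<le> h * (2 * (LINT t|lebesgue_on {s+h..T}. K t) + Cb * CF * h)"
        by (simp add: algebra_simps)
      then have "0 \<le> 2 * (LINT t|lebesgue_on {s+h..T}. K t) + Cb * CF * h"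
        using h by (simp add: zero_le_mult_iff)
      moreover have "(LINT t|lebesgue_on {s+h..T}. K t)
          = (LINT t|lebesgue_on {s+h..T}. ?bF t) + 2 * Cb * (LINT t|lebesgue_on {s+h..T}. \<rho> t)
            + (\<Sum>g\<in>V. Cb * L2_norm \<Omega> g * J (\<kappa> g) h) + Cb * J \<rho> h"
        unfolding K_def J_def using ibF' i\<rho>' iD'
        by (simp add: Bochner_Integration.integral_add Bochner_Integration.integral_sum
            Bochner_Integration.integrable_sum)
      moreover have "(LINT t|lebesgue_on {s+h..T}. \<rho> t) \<le> \<epsilon>"
      proof -
        have "0 \<le> (LINT t|lebesgue_on {s..s+h}. \<rho> t)"
          by (intro Bochner_Integration.integral_nonneg) (simp add: \<rho>_def L2_norm_nonneg)
        moreover have "(LINT t|lebesgue_on {s..T}. \<rho> t)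
            = (LINT t|lebesgue_on {s..s+h}. \<rho> t) + (LINT t|lebesgue_on {s+h..T}. \<rho> t)"
          using h by (intro Equivalence_Measurable_On_Borel.integral_combine ess_bounded_integrable \<rho> s) auto
        ultimately show ?thesis using S\<epsilon> by (simp add: \<rho>_def)
      qed
      then have "2 * Cb * (LINT t|lebesgue_on {s+h..T}. \<rho> t) \<le> 2 * Cb * \<epsilon>"
        using Cb(1) by (intro mult_left_mono) auto
      moreover have "(LINT t|lebesgue_on {s+h..T}. ?bF t) \<le> (LINT t|lebesgue_on {s..T}. ?bF t) + Cb * CF * h"
      proof -
        have "AE t in lebesgue_on {s..s+h}. - ?bF t \<le> Cb * CF"
          using AE_lebesgue_on_Icc[OF Cb(2) s(1)] AE_lebesgue_on_Icc[OF CF(2) s(1)]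
        proof eventually_elim
          case (elim t)
          then have "L2_norm \<Omega> (b t) * L2_norm \<Omega> (F t) \<le> Cb * CF"
            using Cb by (intro mult_mono) (auto simp: L2_norm_nonneg)
          then show ?case using L2_inner_Cauchy_Schwarz[of "b t" \<Omega> "F t"] elim by auto
        qed
        then have "(LINT t|lebesgue_on {s..s+h}. - ?bF t) \<le> Cb * CF * (s + h - s)"
          using h by (intro integral_lebesgue_on_Icc_bound Bochner_Integration.integrable_minus ibF s) auto
        moreover have "(LINT t|lebesgue_on {s..T}. ?bF t)
            = (LINT t|lebesgue_on {s..s+h}. ?bF t) + (LINT t|lebesgue_on {s+h..T}. ?bF t)"
          using h by (intro Equivalence_Measurable_On_Borel.integral_combine ibF s) auto
        ultimately show ?thesis by simp
      qed
      moreover have "0 \<le> Cb * CF * h" using Cb CF h by simp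
      ultimately show ?thesis unfolding R_def by linarith
    qed
    have "(R \<longlongrightarrow> (\<Sum>g\<in>V. Cb * L2_norm \<Omega> g * 0) + Cb * 0 + 2 * (Cb * CF * 0)) (at_right 0)"
      unfolding R_def by (intro tendsto_intros J \<kappa> \<rho>)
    then have "((\<lambda>h. (LINT t|lebesgue_on {s..T}. ?bF t) + 2 * Cb * \<epsilon> + R h)
        \<longlongrightarrow> (LINT t|lebesgue_on {s..T}. ?bF t) + 2 * Cb * \<epsilon> + 0) (at_right 0)"
      by (intro tendsto_intros) simp
    moreover have "\<forall>\<^sub>F h in at_right 0. 0 \<le> (LINT t|lebesgue_on {s..T}. ?bF t) + 2 * Cb * \<epsilon> + R h"
      unfolding eventually_at_right_field using main s by (intro exI[of _ "T - s"]) auto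
    ultimately have "0 \<le> (LINT t|lebesgue_on {s..T}. ?bF t) + 2 * Cb * \<epsilon> + 0"
      by (intro tendsto_lowerbound) auto
    then show ?thesis by simp
  qed
  show ?thesis
  proof (rule field_le_epsilon)
    fix e :: real assume "e > 0"
    \<comment> \<open>The denominator \<open>2 * Cb + 1\<close> is positive even if Cb = 0 and makes
      the error at most e.\<close>
    then have "0 \<le> (LINT t|lebesgue_on {s..T}. ?bF t) + 2 * Cb * (e / (2 * Cb + 1))"
      using Cb by (intro key) auto
    also have "2 * Cb * (e / (2 * Cb + 1)) \<le> e"
      using Cb(1) \<open>e > 0\<close> by (simp add: field_simps)
    finally show "0 \<le> (LINT t|lebesgue_on {s..T}. ?bF t) + e" by simp
  qed
qed

section \<open>Uniqueness\<close>

text \<open>This is nonnegativity of the variance of \<phi> about its mean value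
  \<open>k\<close>.\<close>

lemma Icc_integral_square_le:
  fixes \<phi> :: "real \<Rightarrow> real"
  assumes \<phi>: "integrable (lebesgue_on {p..q}) \<phi>" "integrable (lebesgue_on {p..q}) (\<lambda>t. (\<phi> t)\<^sup>2)" and "p < q"
  shows "(LINT t|lebesgue_on {p..q}. \<phi> t)\<^sup>2 \<le> (q - p) * (LINT t|lebesgue_on {p..q}. (\<phi> t)\<^sup>2)"
proof -
  define Y where "Y = (LINT t|lebesgue_on {p..q}. \<phi> t)"
  define X where "X = (LINT t|lebesgue_on {p..q}. (\<phi> t)\<^sup>2)"
  define k where "k = Y / (q - p)"
  have "0 \<le> (LINT t|lebesgue_on {p..q}. (\<phi> t - k)\<^sup>2)"
    by (intro Bochner_Integration.integral_nonneg) simp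
  also have "\<dots> = (LINT t|lebesgue_on {p..q}. (\<phi> t)\<^sup>2 - 2 * k * \<phi> t + k\<^sup>2)"
    by (intro Bochner_Integration.integral_cong) (auto simp: power2_diff algebra_simps)
  also have "\<dots> = X - 2 * k * Y + k\<^sup>2 * (q - p)"
    using \<phi> \<open>p < q\<close> finite_measure.integrable_const[OF finite_measure_lebesgue_on_Icc, of p q "k\<^sup>2"]
    by (simp add: X_def Y_def measure_restrict_space)
  finally have "0 \<le> (q - p) * (X - 2 * k * Y + k\<^sup>2 * (q - p))"
    using \<open>p < q\<close> by simp
  also have "\<dots> = (q - p) * X - 2 * (k * (q - p)) * Y + (k * (q - p))\<^sup>2"
    by (simp add: power2_eq_square algebra_simps)
  also have "k * (q - p) = Y" using \<open>p < q\<close> by (simp add: k_def)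
  finally show ?thesis
    unfolding X_def[symmetric] Y_def[symmetric] by (simp add: power2_eq_square)
qed

text \<open>The scalar core, to be applied with n = \<parallel>z\<parallel> and \<phi> =
  \<parallel>F\<parallel>. The energy hypothesis can start only at zeros of n, so the argument
  advances by intervals, each ending at a new zero.\<close>

lemma vanishing_of_energy_inequality:
  fixes n \<phi> :: "real \<Rightarrow> real"
  assumes \<phi>: "ess_bounded \<phi>" "ess_bounded (\<lambda>t. (\<phi> t)\<^sup>2)" "\<And>t. 0 \<le> \<phi> t" and s: "0 \<le> s"
    and n: "\<And>t. 0 \<le> n t" "n s = 0"
    and growth: "\<And>p q. s \<le> p \<Longrightarrow> p \<le> q \<Longrightarrow> n q \<le> n p + (LINT t|lebesgue_on {p..q}. \<phi> t)"
    and energy: "\<And>p q M. s \<le> p \<Longrightarrow> p < q \<Longrightarrow> n p = 0 \<Longrightarrow> (\<And>t. t \<in> {p..q} \<Longrightarrow> n t \<le> M) \<Longrightarrow>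
      \<sigma> * (LINT t|lebesgue_on {p..q}. (\<phi> t)\<^sup>2) \<le> L * M * (LINT t|lebesgue_on {p..q}. \<phi> t)"
    and \<sigma>: "0 < \<sigma>" and L: "0 \<le> L" and t: "s \<le> t"
  shows "n t = 0"
proof -
  \<comment> \<open>Chosen so that L \<delta> < \<sigma>, also when L = 0; independent of the
    starting point.\<close>
  define \<delta> where "\<delta> = \<sigma> / (2 * (L + 1))"
  have \<delta>: "0 < \<delta>" "L * \<delta> < \<sigma>"
    using \<sigma> L by (auto simp: \<delta>_def field_simps add_nonneg_pos)
  have step: "n r = 0" if p: "s \<le> p" "n p = 0" and r: "r \<in> {p..p+\<delta>}" for p r
  proof -
    define X where "X = (LINT t|lebesgue_on {p..p+\<delta>}. (\<phi> t)\<^sup>2)"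
    define Y where "Y = (LINT t|lebesgue_on {p..p+\<delta>}. \<phi> t)"
    have i: "integrable (lebesgue_on {c..d}) \<phi>" "integrable (lebesgue_on {c..d}) (\<lambda>t. (\<phi> t)\<^sup>2)"
      if "s \<le> c" for c d
      using \<phi> s that by (auto intro!: ess_bounded_integrable)
    \<comment> \<open>Starting from n p = 0, n can grow by at most the whole integral Y, so M = Y is
      admissible in \<open>energy\<close>.\<close>
    have nY: "n r \<le> Y" if "r \<in> {p..p+\<delta>}" for r
    proof -
      have "0 \<le> (LINT t|lebesgue_on {r..p+\<delta>}. \<phi> t)"
        by (intro Bochner_Integration.integral_nonneg \<phi>)
      moreover have "Y = (LINT t|lebesgue_on {p..r}. \<phi> t) + (LINT t|lebesgue_on {r..p+\<delta>}. \<phi> t)"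
        unfolding Y_def using that p by (intro Equivalence_Measurable_On_Borel.integral_combine i) auto
      ultimately show ?thesis using growth[of p r] that p by auto
    qed
    have Y2: "Y\<^sup>2 \<le> \<delta> * X"
      using Icc_integral_square_le[OF i[OF p(1)], of "p + \<delta>"] \<delta> by (simp add: X_def Y_def)
    have "\<sigma> * X \<le> L * Y * Y"
      unfolding X_def using \<delta> nY energy[OF p(1) _ p(2), of "p + \<delta>" Y] by (simp add: Y_def)
    also have "\<dots> \<le> L * (\<delta> * X)"
      using Y2 L by (simp add: power2_eq_square mult.assoc mult_left_mono)
    finally have "(\<sigma> - L * \<delta>) * X \<le> 0" by (simp add: algebra_simps)
    then have "X \<le> 0" using \<delta> by (simp add: mult_le_0_iff)
    then have "Y\<^sup>2 \<le> 0" using Y2 \<delta> by (smt (verit) mult_nonneg_nonpos)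
    then have "Y = 0" by simp
    then show ?thesis using nY[OF r] n(1)[of r] by simp
  qed
  have "n r = 0" if "r \<in> {s..s + real k * \<delta>}" for r k
    using that
  proof (induction k arbitrary: r)
    case 0
    then show ?case using n by simp
  next
    case (Suc k)
    show ?case
    proof (cases "r \<le> s + real k * \<delta>")
      case True
      with Suc.prems have "r \<in> {s..s + real k * \<delta>}" by simp
      then show ?thesis by (rule Suc.IH)
    next
      case False
      have "n (s + real k * \<delta>) = 0" using \<delta> by (intro Suc.IH) auto
      then show ?thesis
        using False Suc.prems \<delta> by (intro step[of "s + real k * \<delta>" r]) (auto simp: distrib_right)
    qed
  qed
  moreover obtain k :: nat where "t - s < real k * \<delta>"
    using reals_Archimedean3[OF \<delta>(1)] by blast
  then have "t \<in> {s..s + real k * \<delta>}" using t by simp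
  ultimately show ?thesis by blast
qed

text \<open>Pairing with a fixed h reduces the H-valued weak derivative to a scalar one; continuity
  in H makes the pairing continuous up to time 0.\<close>

lemma L2_inner_time_FTC:
  assumes u: "H_continuous \<Omega> u" "\<And>t. 0 \<le> t \<Longrightarrow> u t \<in> L2 \<Omega>"
    and w: "w \<in> Linf_time \<Omega>" "is_time_derivative \<Omega> u w"
    and h: "h \<in> L2 \<Omega>" and pq: "0 \<le> p" "p \<le> q"
  shows "L2_inner \<Omega> (u q) h - L2_inner \<Omega> (u p) h = (LINT t|lebesgue_on {p..q}. L2_inner \<Omega> (w t) h)"
proof (rule weak_derivative_FTC[where m = "\<lambda>t. L2_inner \<Omega> (u t) h", OF _ _ _ pq])
  show "continuous_on {0..} (\<lambda>t. L2_inner \<Omega> (u t) h)"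
    unfolding continuous_on_def
  proof
    fix t :: real assume t: "t \<in> {0..}"
    let ?d = "\<lambda>\<tau>. L2_norm \<Omega> (\<lambda>x. u \<tau> x - u t x)"
    have lim: "((\<lambda>\<tau>. ?d \<tau> * L2_norm \<Omega> h) \<longlongrightarrow> 0 * L2_norm \<Omega> h) (at t within {0..})"
      using u(1) t by (intro tendsto_intros) (auto simp: H_continuous_def)
    have "norm (L2_inner \<Omega> (u \<tau>) h - L2_inner \<Omega> (u t) h) \<le> ?d \<tau> * L2_norm \<Omega> h" if "0 \<le> \<tau>" for \<tau>
      using L2_inner_Cauchy_Schwarz[OF L2_diff[OF u(2)[OF that] u(2)[of t]] h]
        L2_inner_diff_left[OF u(2)[OF that] u(2)[of t] h] t by simp
    then have le: "\<forall>\<^sub>F \<tau> in at t within {0..}.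
        norm (L2_inner \<Omega> (u \<tau>) h - L2_inner \<Omega> (u t) h) \<le> ?d \<tau> * L2_norm \<Omega> h"
      by (auto simp: eventually_at_filter)
    have "((\<lambda>\<tau>. L2_inner \<Omega> (u \<tau>) h - L2_inner \<Omega> (u t) h) \<longlongrightarrow> 0) (at t within {0..})"
      using Lim_null_comparison[OF le] lim by simp
    then show "((\<lambda>\<tau>. L2_inner \<Omega> (u \<tau>) h) \<longlongrightarrow> L2_inner \<Omega> (u t) h) (at t within {0..})"
      by (rule LIM_zero_cancel)
  qed
  show "ess_bounded (\<lambda>t. L2_inner \<Omega> (w t) h)"
    by (intro Linf_time_inner w Linf_time_const h)
  show "(LINT t|lebesgue_on {0<..}. deriv \<phi> t * L2_inner \<Omega> (u t) h)
      = - (LINT t|lebesgue_on {0<..}. \<phi> t * L2_inner \<Omega> (w t) h)" if "test_function {0<..} \<phi>" for \<phi>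
    using w(2) that h by (simp add: is_time_derivative_def)
qed

section \<open>The quadratic form of the Dirichlet Laplacian\<close>

lemma B_represented_by_B_op:
  "B_represented_by \<Omega> u g \<Longrightarrow> B_represented_by \<Omega> u (B_op \<Omega> u)"
  unfolding B_op_def by (rule someI[where P = "B_represented_by \<Omega> u"])

lemma is_weak_grad_weak_grad: "u \<in> H10 \<Omega> \<Longrightarrow> is_weak_grad \<Omega> u (weak_grad \<Omega> u)"
  unfolding weak_grad_def H10_def H1_def by (auto intro: someI[where P = "is_weak_grad \<Omega> u"])

lemma integrable_inner_of_square_integrable:
  fixes G H :: "'a::euclidean_space \<Rightarrow> 'a"
  assumes "G \<in> borel_measurable M" "H \<in> borel_measurable M"
    and "integrable M (\<lambda>x. (norm (G x))\<^sup>2)" "integrable M (\<lambda>x. (norm (H x))\<^sup>2)"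
  shows "integrable M (\<lambda>x. G x \<bullet> H x)"
proof (rule Bochner_Integration.integrable_bound)
  show "integrable M (\<lambda>x. (norm (G x))\<^sup>2 + (norm (H x))\<^sup>2)"
    using assms by (intro Bochner_Integration.integrable_add)
  show "(\<lambda>x. G x \<bullet> H x) \<in> borel_measurable M"
    using assms by (intro borel_measurable_inner)
  have "\<bar>G x \<bullet> H x\<bar> \<le> (norm (G x))\<^sup>2 + (norm (H x))\<^sup>2" for x
    using Cauchy_Schwarz_ineq2[of "G x" "H x"] sum_squares_bound[of "norm (G x)" "norm (H x)"]
      mult_nonneg_nonneg[of "norm (G x)" "norm (H x)"] by simp
  then show "AE x in M. norm (G x \<bullet> H x) \<le> norm ((norm (G x))\<^sup>2 + (norm (H x))\<^sup>2)"
    by (intro AE_I2) simp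
qed

lemma integrable_weak_grad_inner:
  assumes "f \<in> H10 \<Omega>" "g \<in> H10 \<Omega>"
  shows "integrable (lebesgue_on \<Omega>) (\<lambda>x. weak_grad \<Omega> f x \<bullet> weak_grad \<Omega> g x)"
  using is_weak_grad_weak_grad[OF assms(1)] is_weak_grad_weak_grad[OF assms(2)]
  by (intro integrable_inner_of_square_integrable) (auto simp: is_weak_grad_def)

text \<open>Working with differences of gradients avoids the additivity of \<open>weak_grad\<close>.\<close>

lemma L2_inner_B_op_diff:
  assumes "B_represented_by \<Omega> u (B_op \<Omega> u)" "B_represented_by \<Omega> v (B_op \<Omega> v)"
    and "u' \<in> H10 \<Omega>" "v' \<in> H10 \<Omega>"
  shows "L2_inner \<Omega> (\<lambda>x. B_op \<Omega> u x - B_op \<Omega> v x) (\<lambda>x. u' x - v' x)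
    = (LINT x|lebesgue_on \<Omega>. (weak_grad \<Omega> u x - weak_grad \<Omega> v x) \<bullet> (weak_grad \<Omega> u' x - weak_grad \<Omega> v' x))"
proof -
  have L2: "B_op \<Omega> u \<in> L2 \<Omega>" "B_op \<Omega> v \<in> L2 \<Omega>" "u' \<in> L2 \<Omega>" "v' \<in> L2 \<Omega>"
    using assms by (auto simp: B_represented_by_def H10_def H1_def)
  have B: "L2_inner \<Omega> (B_op \<Omega> f) g = B_pairing \<Omega> f g"
    if "f = u \<or> f = v" "g = u' \<or> g = v'" for f g
    using assms that by (auto simp: B_represented_by_def)
  have "u \<in> H10 \<Omega>" "v \<in> H10 \<Omega>"
    using assms by (auto simp: B_represented_by_def)
  then have int: "integrable (lebesgue_on \<Omega>) (\<lambda>x. weak_grad \<Omega> f x \<bullet> weak_grad \<Omega> g x)"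
    if "f = u \<or> f = v" "g = u' \<or> g = v'" for f g
    using assms that integrable_weak_grad_inner by blast
  have "L2_inner \<Omega> (\<lambda>x. B_op \<Omega> u x - B_op \<Omega> v x) (\<lambda>x. u' x - v' x)
      = (B_pairing \<Omega> u u' - B_pairing \<Omega> u v') - (B_pairing \<Omega> v u' - B_pairing \<Omega> v v')"
    using L2 by (simp add: L2_inner_diff_left L2_inner_diff_right L2_diff B)
  then show ?thesis
    by (simp add: B_pairing_def inner_diff_left inner_diff_right int)
qed

text \<open>Expand |G - H|^2 \<ge> 0 for the two differences of gradients; this is convexity of the
  Dirichlet energy. For the energy estimate, u, v are taken at the later time and u', v' at the
  earlier one.\<close>

lemma L2_inner_B_op_psd:
  assumes "B_represented_by \<Omega> u (B_op \<Omega> u)" "B_represented_by \<Omega> v (B_op \<Omega> v)"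
    and "B_represented_by \<Omega> u' (B_op \<Omega> u')" "B_represented_by \<Omega> v' (B_op \<Omega> v')"
  shows "2 * L2_inner \<Omega> (\<lambda>x. B_op \<Omega> u x - B_op \<Omega> v x) (\<lambda>x. u' x - v' x)
      \<le> L2_inner \<Omega> (\<lambda>x. B_op \<Omega> u x - B_op \<Omega> v x) (\<lambda>x. u x - v x)
        + L2_inner \<Omega> (\<lambda>x. B_op \<Omega> u' x - B_op \<Omega> v' x) (\<lambda>x. u' x - v' x)"
    and "0 \<le> L2_inner \<Omega> (\<lambda>x. B_op \<Omega> u x - B_op \<Omega> v x) (\<lambda>x. u x - v x)"
proof -
  let ?G = "\<lambda>x. weak_grad \<Omega> u x - weak_grad \<Omega> v x" and ?H = "\<lambda>x. weak_grad \<Omega> u' x - weak_grad \<Omega> v' x"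
  have H10: "u \<in> H10 \<Omega>" "v \<in> H10 \<Omega>" "u' \<in> H10 \<Omega>" "v' \<in> H10 \<Omega>"
    using assms by (auto simp: B_represented_by_def)
  have intG: "integrable (lebesgue_on \<Omega>) (\<lambda>x. ?G x \<bullet> ?G x)" "integrable (lebesgue_on \<Omega>) (\<lambda>x. ?G x \<bullet> ?H x)"
    "integrable (lebesgue_on \<Omega>) (\<lambda>x. ?H x \<bullet> ?H x)"
    unfolding inner_diff_left inner_diff_right
    by (intro Bochner_Integration.integrable_diff integrable_weak_grad_inner H10)+
  have "0 \<le> (LINT x|lebesgue_on \<Omega>. (?G x - ?H x) \<bullet> (?G x - ?H x))"
    by (intro Bochner_Integration.integral_nonneg) simp
  also have "\<dots> = (LINT x|lebesgue_on \<Omega>. ?G x \<bullet> ?G x - 2 * (?G x \<bullet> ?H x) + ?H x \<bullet> ?H x)"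
    by (intro Bochner_Integration.integral_cong) (simp_all add: inner_diff_left inner_diff_right inner_commute)
  also have "\<dots> = (LINT x|lebesgue_on \<Omega>. ?G x \<bullet> ?G x) - 2 * (LINT x|lebesgue_on \<Omega>. ?G x \<bullet> ?H x)
      + (LINT x|lebesgue_on \<Omega>. ?H x \<bullet> ?H x)"
    using intG by simp
  finally show "2 * L2_inner \<Omega> (\<lambda>x. B_op \<Omega> u x - B_op \<Omega> v x) (\<lambda>x. u' x - v' x)
      \<le> L2_inner \<Omega> (\<lambda>x. B_op \<Omega> u x - B_op \<Omega> v x) (\<lambda>x. u x - v x)
        + L2_inner \<Omega> (\<lambda>x. B_op \<Omega> u' x - B_op \<Omega> v' x) (\<lambda>x. u' x - v' x)"
    unfolding L2_inner_B_op_diff[OF assms(1,2) H10(3,4)] L2_inner_B_op_diff[OF assms(1,2) H10(1,2)]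
      L2_inner_B_op_diff[OF assms(3,4) H10(3,4)] by linarith
  show "0 \<le> L2_inner \<Omega> (\<lambda>x. B_op \<Omega> u x - B_op \<Omega> v x) (\<lambda>x. u x - v x)"
    unfolding L2_inner_B_op_diff[OF assms(1,2) H10(1,2)]
    by (intro Bochner_Integration.integral_nonneg) simp
qed

section \<open>Confinement of the solutions to a compact subset of the interval\<close>

lemma Linf_norm_le_imp_AE:
  assumes "u \<in> Linf \<Omega>" "Linf_norm \<Omega> u \<le> c"
  shows "AE x in lebesgue_on \<Omega>. \<bar>u x\<bar> \<le> c"
proof -
  let ?e = "esssup (lebesgue_on \<Omega>) (\<lambda>x. ereal \<bar>u x\<bar>)"
  have "AE x in lebesgue_on \<Omega>. ereal \<bar>u x\<bar> \<le> ?e"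
    by (rule esssup_AE)
  then show ?thesis
  proof eventually_elim
    case (elim x)
    then show ?case
      using assms by (cases ?e) (auto simp: Linf_def Linf_norm_def)
  qed
qed

lemma Linf_iff:
  "u \<in> Linf \<Omega> \<longleftrightarrow> u \<in> borel_measurable (lebesgue_on \<Omega>) \<and> (\<exists>C. AE x in lebesgue_on \<Omega>. \<bar>u x\<bar> \<le> C)"
proof
  assume "u \<in> Linf \<Omega>"
  then show "u \<in> borel_measurable (lebesgue_on \<Omega>) \<and> (\<exists>C. AE x in lebesgue_on \<Omega>. \<bar>u x\<bar> \<le> C)"
    using Linf_norm_le_imp_AE by (auto simp: Linf_def)
next
  assume u: "u \<in> borel_measurable (lebesgue_on \<Omega>) \<and> (\<exists>C. AE x in lebesgue_on \<Omega>. \<bar>u x\<bar> \<le> C)"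
  then obtain C where "AE x in lebesgue_on \<Omega>. ereal \<bar>u x\<bar> \<le> ereal C" by auto
  then have "esssup (lebesgue_on \<Omega>) (\<lambda>x. ereal \<bar>u x\<bar>) \<le> ereal C"
    using u by (intro esssup_I) auto
  also have "\<dots> < \<infinity>" by simp
  finally show "u \<in> Linf \<Omega>" using u by (simp add: Linf_def)
qed

text \<open>The distance to 0 bounds both u and W'(u) + lam u by c, because W'(0) = 0; subtracting
  lam u costs at most lam c.\<close>

lemma Xinf_dinf_bound_imp_AE:
  assumes u: "u \<in> Xinf \<Omega> I W" and c: "dinf \<Omega> W lam u (\<lambda>x. 0) \<le> c" and "deriv W 0 = 0" "0 \<le> lam"
  shows "AE x in lebesgue_on \<Omega>. u x \<in> I \<and> \<bar>deriv W (u x)\<bar> \<le> c + lam * c"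
proof -
  let ?w = "\<lambda>x. deriv W (u x) + lam * u x"
  have uW: "u \<in> Linf \<Omega>" "(\<lambda>x. deriv W (u x)) \<in> Linf \<Omega>" "AE x in lebesgue_on \<Omega>. u x \<in> I"
    using u by (auto simp: Xinf_def)
  \<comment> \<open>Membership of \<open>?w\<close> in \<open>Linf\<close> must come before any use
    of its norm: \<open>Linf_norm\<close> is 0 when the essential supremum is infinite.\<close>
  obtain C1 C2 where "AE x in lebesgue_on \<Omega>. \<bar>u x\<bar> \<le> C1" "AE x in lebesgue_on \<Omega>. \<bar>deriv W (u x)\<bar> \<le> C2"
    using uW by (auto simp: Linf_iff)
  then have "AE x in lebesgue_on \<Omega>. \<bar>?w x\<bar> \<le> C2 + lam * C1"
  proof eventually_elim
    case (elim x)
    have "\<bar>lam * u x\<bar> \<le> lam * C1"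
      using elim(1) \<open>0 \<le> lam\<close> by (simp add: abs_mult mult_left_mono)
    with elim(2) show ?case by linarith
  qed
  moreover have "?w \<in> borel_measurable (lebesgue_on \<Omega>)"
    using uW by (intro borel_measurable_add borel_measurable_times borel_measurable_const) (simp_all add: Linf_def)
  ultimately have w: "?w \<in> Linf \<Omega>" by (auto simp: Linf_iff)
  have "Linf_norm \<Omega> u \<le> dinf \<Omega> W lam u (\<lambda>x. 0)" "Linf_norm \<Omega> ?w \<le> dinf \<Omega> W lam u (\<lambda>x. 0)"
    unfolding dinf_def using \<open>deriv W 0 = 0\<close> by (auto intro!: real_le_rsqrt)
  then have "Linf_norm \<Omega> u \<le> c" "Linf_norm \<Omega> ?w \<le> c" using c by auto
  then have "AE x in lebesgue_on \<Omega>. \<bar>u x\<bar> \<le> c" "AE x in lebesgue_on \<Omega>. \<bar>?w x\<bar> \<le> c"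
    using uW(1) w by (auto intro: Linf_norm_le_imp_AE)
  then show ?thesis
    using uW(3)
  proof eventually_elim
    case (elim x)
    have "\<bar>lam * u x\<bar> \<le> lam * c"
      using elim(1) \<open>0 \<le> lam\<close> by (simp add: abs_mult mult_left_mono)
    with elim show ?case by auto
  qed
qed

text \<open>Near either end g r sgn r is at least M + 1, and so is |g r|; the sublevel set is
  therefore caught between two interior points \<open>r1\<close> and \<open>r2\<close>. The filters
  live on \<open>ereal\<close> so that infinite ends are covered.\<close>

lemma compact_sublevel_of_blowup:
  fixes a b :: ereal and g :: "real \<Rightarrow> real"
  assumes I: "0 \<in> einterval a b"
    and left: "filterlim ((\<lambda>r. g r * sgn r) \<circ> real_of_ereal) at_top (at_right a)"
    and right: "filterlim ((\<lambda>r. g r * sgn r) \<circ> real_of_ereal) at_top (at_left b)"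
  obtains K where "compact K" "K \<subseteq> einterval a b" "\<And>r. r \<in> einterval a b \<Longrightarrow> \<bar>g r\<bar> \<le> M \<Longrightarrow> r \<in> K"
proof -
  have ab: "a < 0" "0 < b" using I by (auto simp: einterval_def zero_ereal_def)
  have le: "g r * sgn r \<le> \<bar>g r\<bar>" for r
    by (auto simp: sgn_if)
  have "\<forall>\<^sub>F x in at_right a. M + 1 \<le> g (real_of_ereal x) * sgn (real_of_ereal x)"
    using left by (auto simp: filterlim_at_top)
  then obtain y where y: "y > a" "\<And>x. a < x \<Longrightarrow> x < y \<Longrightarrow> M + 1 \<le> g (real_of_ereal x) * sgn (real_of_ereal x)"
    unfolding eventually_at_right[OF ab(1)] by blast
  obtain r1 where r1: "a < ereal r1" "ereal r1 < min y 0"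
    using ereal_dense2[of a "min y 0"] y ab by auto
  have "\<forall>\<^sub>F x in at_left b. M + 1 \<le> g (real_of_ereal x) * sgn (real_of_ereal x)"
    using right by (auto simp: filterlim_at_top)
  then obtain y' where y': "y' < b" "\<And>x. y' < x \<Longrightarrow> x < b \<Longrightarrow> M + 1 \<le> g (real_of_ereal x) * sgn (real_of_ereal x)"
    unfolding eventually_at_left[OF ab(2)] by blast
  obtain r2 where r2: "max y' 0 < ereal r2" "ereal r2 < b"
    using ereal_dense2[of "max y' 0" b] y' ab by auto
  show thesis
  proof (rule that[of "{r1..r2}"])
    show "{r1..r2} \<subseteq> einterval a b"
    proof
      fix x assume "x \<in> {r1..r2}"
      then have "ereal r1 \<le> ereal x" "ereal x \<le> ereal r2" by auto
      then have "a < ereal x" "ereal x < b"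
        using r1(1) r2(2) by (metis less_le_trans, metis le_less_trans)
      then show "x \<in> einterval a b"
        by (simp add: einterval_def)
    qed
    fix r assume r: "r \<in> einterval a b" "\<bar>g r\<bar> \<le> M"
    then have rab: "a < ereal r" "ereal r < b" by (auto simp: einterval_def)
    have "\<not> r < r1"
    proof
      assume "r < r1"
      then have "ereal r < y" using r1(2) by (metis less_ereal.simps(1) less_trans min_less_iff_conj)
      then show False using y(2)[OF rab(1)] le[of r] r by simp
    qed
    moreover have "\<not> r2 < r"
    proof
      assume "r2 < r"
      then have "y' < ereal r" using r2(1) by (metis less_ereal.simps(1) less_trans max_less_iff_conj)
      then show False using y'(2)[OF _ rab(2)] le[of r] r by simp
    qed
    ultimately show "r \<in> {r1..r2}" by auto
  qed simp
qed

section \<open>Monotonicity of \<alpha> and the coercive estimate\<close>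

lemma strongly_monotone_of_deriv_ge:
  fixes \<alpha> :: "real \<Rightarrow> real"
  assumes "\<And>r. \<alpha> differentiable (at r)" "\<And>r. deriv \<alpha> r \<ge> \<sigma>"
  shows "\<sigma> * (x - y)\<^sup>2 \<le> (\<alpha> x - \<alpha> y) * (x - y)"
proof -
  have D: "(\<alpha> has_real_derivative deriv \<alpha> r) (at r)" for r
    using assms(1) by (simp add: DERIV_deriv_iff_real_differentiable)
  have *: "\<sigma> * (x - y)\<^sup>2 \<le> (\<alpha> x - \<alpha> y) * (x - y)" if yx: "y < x" for x y
  proof -
    obtain r where "\<alpha> x - \<alpha> y = (x - y) * deriv \<alpha> r"
      using MVT2[OF yx D] by blast
    then have "(\<alpha> x - \<alpha> y) * (x - y) = deriv \<alpha> r * (x - y)\<^sup>2"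
      by (simp add: power2_eq_square)
    then show ?thesis using assms(2)[of r] by (simp add: mult_right_mono)
  qed
  show ?thesis
    using *[of y x] *[of x y] by (cases x y rule: linorder_cases) (auto simp: power2_commute algebra_simps)
qed

lemma L2_abs: "f \<in> L2 \<Omega> \<Longrightarrow> (\<lambda>x. \<bar>f x\<bar>) \<in> L2 \<Omega>"
  by (auto simp: L2_def)

lemma L2_norm_abs: "L2_norm \<Omega> (\<lambda>x. \<bar>f x\<bar>) = L2_norm \<Omega> f"
  by (simp add: L2_norm_def L2_inner_def flip: power2_eq_square)

lemma L2_inner_coercive_le:
  assumes b: "b \<in> L2 \<Omega>" and F: "F \<in> L2 \<Omega>" and z: "z \<in> L2 \<Omega>" and L: "0 \<le> L"
    and le: "AE x in lebesgue_on \<Omega>. b x * F x \<le> - \<sigma> * (F x)\<^sup>2 + L * (\<bar>z x\<bar> * \<bar>F x\<bar>)"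
  shows "L2_inner \<Omega> b F \<le> - \<sigma> * (L2_norm \<Omega> F)\<^sup>2 + L * (L2_norm \<Omega> z * L2_norm \<Omega> F)"
proof -
  have i: "integrable (lebesgue_on \<Omega>) (\<lambda>x. (F x)\<^sup>2)" "integrable (lebesgue_on \<Omega>) (\<lambda>x. \<bar>z x\<bar> * \<bar>F x\<bar>)"
    using F L2_integrable_mult[OF L2_abs[OF z] L2_abs[OF F]] by (auto simp: L2_def)
  have "L2_inner \<Omega> b F \<le> (LINT x|lebesgue_on \<Omega>. - \<sigma> * (F x)\<^sup>2 + L * (\<bar>z x\<bar> * \<bar>F x\<bar>))"
    unfolding L2_inner_def
    by (intro integral_mono_AE le L2_integrable_mult b F Bochner_Integration.integrable_add
        integrable_mult_right i)
  also have "\<dots> = - \<sigma> * (L2_norm \<Omega> F)\<^sup>2 + L * L2_inner \<Omega> (\<lambda>x. \<bar>z x\<bar>) (\<lambda>x. \<bar>F x\<bar>)"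
    using i by (simp add: L2_norm_square L2_inner_def flip: power2_eq_square)
  also have "\<dots> \<le> - \<sigma> * (L2_norm \<Omega> F)\<^sup>2 + L * (L2_norm \<Omega> z * L2_norm \<Omega> F)"
    using L2_inner_Cauchy_Schwarz[OF L2_abs[OF z] L2_abs[OF F]] L
    by (intro add_left_mono mult_left_mono) (auto simp: L2_norm_abs)
  finally show ?thesis .
qed

lemma L2_norm_eq_0_iff:
  assumes "f \<in> L2 \<Omega>"
  shows "L2_norm \<Omega> f = 0 \<longleftrightarrow> (AE x in lebesgue_on \<Omega>. f x = 0)"
proof -
  have "L2_norm \<Omega> f = 0 \<longleftrightarrow> (LINT x|lebesgue_on \<Omega>. f x * f x) = 0"
    by (simp add: L2_norm_def L2_inner_def)
  also have "\<dots> \<longleftrightarrow> (AE x in lebesgue_on \<Omega>. f x * f x = 0)"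
    by (rule integral_nonneg_eq_0_iff_AE[OF L2_integrable_mult[OF assms assms]]) simp
  finally show ?thesis by simp
qed

theorem corollary3p8:
  fixes \<Omega> :: "(real ^ 'n::finite) set"
    and \<alpha> W :: "real \<Rightarrow> real"
    and \<sigma> lam \<eta> s c :: real
    and a b :: ereal
    and I :: "real set"
    and f u0 v0 :: "real ^ 'n \<Rightarrow> real"
    and u v :: "real \<Rightarrow> real ^ 'n \<Rightarrow> real"
  assumes dim: "1 \<le> CARD('n)" "CARD('n) \<le> 3"
    and dom: "smooth_bounded_domain \<Omega>"
    and alpha_C1: "\<And>r. \<alpha> differentiable (at r)" "continuous_on UNIV (deriv \<alpha>)"
    and alpha_0: "\<alpha> 0 = 0"
    and alpha_mono: "\<sigma> > 0" "\<And>r. deriv \<alpha> r \<ge> \<sigma>"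
    and lambda: "lam \<ge> 0"
    and interval: "I = einterval a b" "0 \<in> I"
    and W_reg: "C11_loc I W"
    and W_crit: "deriv W 0 = 0"
    and W_second: "AE r in lebesgue_on I. \<exists>D\<ge>-lam. (deriv W has_real_derivative D) (at r)"
    and W_left: "filterlim ((\<lambda>r. deriv W r * sgn r) \<circ> real_of_ereal) at_top (at_right a)"
    and W_right: "filterlim ((\<lambda>r. deriv W r * sgn r) \<circ> real_of_ereal) at_top (at_left b)"
    and W_coercive: "\<eta> > 0" "\<And>r. r \<in> I \<Longrightarrow> W r \<ge> \<eta> * r\<^sup>2 / 2"
    and f: "f \<in> Linf \<Omega>"
    and data: "u0 \<in> X2 \<Omega> I W" "v0 \<in> X2 \<Omega> I W"
    and u: "X2_solution \<Omega> \<alpha> I W lam f u0 u"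
    and v: "X2_solution \<Omega> \<alpha> I W lam f v0 v"
    and sc: "s \<ge> 0" "c \<ge> 0"
    and eq_s: "AE x in lebesgue_on \<Omega>. u s x = v s x"
    and Xinf: "\<And>t. t \<ge> s \<Longrightarrow> u t \<in> Xinf \<Omega> I W" "\<And>t. t \<ge> s \<Longrightarrow> v t \<in> Xinf \<Omega> I W"
    and bound: "\<And>t. t \<ge> s \<Longrightarrow> dinf \<Omega> W lam (u t) (\<lambda>x. 0) + dinf \<Omega> W lam (v t) (\<lambda>x. 0) \<le> c"
  shows "\<forall>t\<ge>s. AE x in lebesgue_on \<Omega>. u t x = v t x"
proof -
  have u_cont: "H_continuous \<Omega> u" and v_cont: "H_continuous \<Omega> v"
    and uX: "\<And>t. 0 \<le> t \<Longrightarrow> u t \<in> X2 \<Omega> I W" and vX: "\<And>t. 0 \<le> t \<Longrightarrow> v t \<in> X2 \<Omega> I W"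
    using u v by (auto simp: X2_solution_def)
  obtain ut where ut: "is_time_derivative \<Omega> u ut" "u \<in> Linf_time \<Omega>" "ut \<in> Linf_time \<Omega>"
    "(\<lambda>t. B_op \<Omega> (u t)) \<in> Linf_time \<Omega>"
    "AE t in lebesgue_on {0<..}. AE x in lebesgue_on \<Omega>. \<alpha> (ut t x) + B_op \<Omega> (u t) x + deriv W (u t x) = f x"
    using u unfolding X2_solution_def by blast
  obtain vt where vt: "is_time_derivative \<Omega> v vt" "v \<in> Linf_time \<Omega>" "vt \<in> Linf_time \<Omega>"
    "(\<lambda>t. B_op \<Omega> (v t)) \<in> Linf_time \<Omega>"
    "AE t in lebesgue_on {0<..}. AE x in lebesgue_on \<Omega>. \<alpha> (vt t x) + B_op \<Omega> (v t) x + deriv W (v t x) = f x"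
    using v unfolding X2_solution_def by blast
  have uB: "B_represented_by \<Omega> (u t) (B_op \<Omega> (u t))" and vB: "B_represented_by \<Omega> (v t) (B_op \<Omega> (v t))"
    and uL2: "u t \<in> L2 \<Omega>" and vL2: "v t \<in> L2 \<Omega>" if "0 \<le> t" for t
    using uX[OF that] vX[OF that] by (auto simp: X2_def intro: B_represented_by_B_op)
  have BL2: "B_op \<Omega> (u t) \<in> L2 \<Omega>" "B_op \<Omega> (v t) \<in> L2 \<Omega>" if "0 \<le> t" for t
    using uB[OF that] vB[OF that] by (auto simp: B_represented_by_def)

  define z where "z t x = u t x - v t x" for t x
  define F where "F t x = ut t x - vt t x" for t x
  \<comment> \<open>From here on \<open>b\<close> is the difference of the Laplacians and no longer
    the right end of \<open>I\<close>.\<close>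
  define b where "b t x = B_op \<Omega> (u t) x - B_op \<Omega> (v t) x" for t x
  have F: "F \<in> Linf_time \<Omega>" and b: "b \<in> Linf_time \<Omega>" and z: "z \<in> Linf_time \<Omega>"
    unfolding F_def[abs_def] b_def[abs_def] z_def[abs_def] by (intro Linf_time_diff ut vt)+
  have zL2: "z t \<in> L2 \<Omega>" and bL2: "b t \<in> L2 \<Omega>" if "0 \<le> t" for t
    unfolding z_def[abs_def] b_def[abs_def] using that by (intro L2_diff uL2 vL2 BL2; simp)+
  have FTC: "L2_inner \<Omega> (\<lambda>x. z q x - z p x) h = (LINT t|lebesgue_on {p..q}. L2_inner \<Omega> (F t) h)"
    if h: "h \<in> L2 \<Omega>" and pq: "0 \<le> p" "p \<le> q" for h p q
  proof -
    have q: "0 \<le> q" using pq by simp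
    have "L2_inner \<Omega> (\<lambda>x. z q x - z p x) h
        = (L2_inner \<Omega> (u q) h - L2_inner \<Omega> (u p) h) - (L2_inner \<Omega> (v q) h - L2_inner \<Omega> (v p) h)"
      using h uL2[OF pq(1)] uL2[OF q] vL2[OF pq(1)] vL2[OF q]
      by (simp add: z_def[abs_def] L2_inner_diff_left L2_diff)
    also have "\<dots> = (LINT t|lebesgue_on {p..q}. L2_inner \<Omega> (ut t) h) - (LINT t|lebesgue_on {p..q}. L2_inner \<Omega> (vt t) h)"
      using L2_inner_time_FTC[OF u_cont uL2 ut(3,1) h pq] L2_inner_time_FTC[OF v_cont vL2 vt(3,1) h pq] by simp
    also have "\<dots> = (LINT t|lebesgue_on {p..q}. L2_inner \<Omega> (ut t) h - L2_inner \<Omega> (vt t) h)"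
      by (intro Bochner_Integration.integral_diff[symmetric] ess_bounded_integrable Linf_time_inner
          Linf_time_const ut vt h pq)
    also have "\<dots> = (LINT t|lebesgue_on {p..q}. L2_inner \<Omega> (F t) h)"
    proof (rule integral_cong_AE)
      have "AE t in lebesgue_on {0<..}. ut t \<in> L2 \<Omega>" "AE t in lebesgue_on {0<..}. vt t \<in> L2 \<Omega>"
        using ut(3) vt(3) by (auto simp: Linf_time_def)
      then have "AE t in lebesgue_on {0<..}. L2_inner \<Omega> (ut t) h - L2_inner \<Omega> (vt t) h = L2_inner \<Omega> (F t) h"
        by eventually_elim (simp add: F_def[abs_def] L2_inner_diff_left h)
      then show "AE t in lebesgue_on {p..q}. L2_inner \<Omega> (ut t) h - L2_inner \<Omega> (vt t) h = L2_inner \<Omega> (F t) h"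
        using pq(1) by (rule AE_lebesgue_on_Icc)
      have "integrable (lebesgue_on {p..q}) (\<lambda>t. L2_inner \<Omega> (ut t) h - L2_inner \<Omega> (vt t) h)"
        by (intro Bochner_Integration.integrable_diff ess_bounded_integrable Linf_time_inner
          Linf_time_const ut vt h pq)
      then show "(\<lambda>t. L2_inner \<Omega> (ut t) h - L2_inner \<Omega> (vt t) h) \<in> borel_measurable (lebesgue_on {p..q})"
        by (rule borel_measurable_integrable)
      have "integrable (lebesgue_on {p..q}) (\<lambda>t. L2_inner \<Omega> (F t) h)"
        by (intro ess_bounded_integrable Linf_time_inner Linf_time_const F h pq)
      then show "(\<lambda>t. L2_inner \<Omega> (F t) h) \<in> borel_measurable (lebesgue_on {p..q})"
        by (rule borel_measurable_integrable)
    qed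
    finally show ?thesis .
  qed

  \<comment> \<open>The level c + lam c is the bound on W'(u) and W'(v) given by the metric. It does
    not depend on time, hence neither do \<open>K\<close> and the Lipschitz constant
    \<open>L\<close>.\<close>
  obtain K where K: "compact K" "K \<subseteq> I" "\<And>r. r \<in> I \<Longrightarrow> \<bar>deriv W r\<bar> \<le> c + lam * c \<Longrightarrow> r \<in> K"
    using compact_sublevel_of_blowup[OF _ W_left W_right, of "c + lam * c"] interval by metis
  obtain L where L: "L-lipschitz_on K (deriv W)"
    using W_reg K by (auto simp: C11_loc_def)
  then have L0: "0 \<le> L" by (rule lipschitz_on_nonneg)
  have dinf_nonneg: "0 \<le> dinf \<Omega> W lam p q" for p q by (simp add: dinf_def)
  have lip: "AE x in lebesgue_on \<Omega>. \<bar>deriv W (u t x) - deriv W (v t x)\<bar> \<le> L * \<bar>z t x\<bar>" if t: "s \<le> t" for t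
  proof -
    have "dinf \<Omega> W lam (u t) (\<lambda>x. 0) \<le> c" "dinf \<Omega> W lam (v t) (\<lambda>x. 0) \<le> c"
      using bound[OF t] dinf_nonneg[of "u t" "\<lambda>x. 0"] dinf_nonneg[of "v t" "\<lambda>x. 0"] by auto
    from Xinf_dinf_bound_imp_AE[OF Xinf(1)[OF t] this(1) W_crit lambda]
      Xinf_dinf_bound_imp_AE[OF Xinf(2)[OF t] this(2) W_crit lambda]
    show ?thesis
    proof eventually_elim
      case (elim x)
      then have "u t x \<in> K" "v t x \<in> K" using K(3) by auto
      then show ?case using lipschitz_onD[OF L] by (simp add: dist_real_def z_def)
    qed
  qed
  have "AE t in lebesgue_on {0<..}. ut t \<in> L2 \<Omega>" "AE t in lebesgue_on {0<..}. vt t \<in> L2 \<Omega>"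
    "AE t in lebesgue_on {0<..}. t > 0"
    using ut(3) vt(3) by (auto simp: Linf_time_def intro: AE_I2)
  \<comment> \<open>The restriction to s \<le> t is an implication under the quantifier, so that the
    statement stays on the half-line and can be restricted to any \<open>{p..q}\<close>
    later.\<close>
  with ut(5) vt(5) have coercive: "AE t in lebesgue_on {0<..}. s \<le> t \<longrightarrow>
      L2_inner \<Omega> (b t) (F t) \<le> - \<sigma> * (L2_norm \<Omega> (F t))\<^sup>2 + L * (L2_norm \<Omega> (z t) * L2_norm \<Omega> (F t))"
  proof eventually_elim
    case (elim t)
    show ?case
    proof
      assume t: "s \<le> t"
      show "L2_inner \<Omega> (b t) (F t) \<le> - \<sigma> * (L2_norm \<Omega> (F t))\<^sup>2 + L * (L2_norm \<Omega> (z t) * L2_norm \<Omega> (F t))"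
      proof (rule L2_inner_coercive_le[OF bL2 _ zL2 L0])
        show "F t \<in> L2 \<Omega>" unfolding F_def[abs_def] by (intro L2_diff elim)
        show "AE x in lebesgue_on \<Omega>. b t x * F t x \<le> - \<sigma> * (F t x)\<^sup>2 + L * (\<bar>z t x\<bar> * \<bar>F t x\<bar>)"
          using elim(1,2) lip[OF t]
        proof eventually_elim
          case (elim x)
          let ?a = "\<alpha> (ut t x) - \<alpha> (vt t x)" and ?w = "deriv W (u t x) - deriv W (v t x)"
          have bx: "b t x = - ?a - ?w" using elim(1,2) by (simp add: b_def)
          have "b t x * F t x = - (?a * F t x) - ?w * F t x"
            unfolding bx by (simp only: left_diff_distrib mult_minus_left)
          moreover have "\<sigma> * (F t x)\<^sup>2 \<le> ?a * F t x"
            unfolding F_def by (rule strongly_monotone_of_deriv_ge[OF alpha_C1(1) alpha_mono(2)])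
          moreover have "\<bar>?w * F t x\<bar> \<le> L * \<bar>z t x\<bar> * \<bar>F t x\<bar>"
            unfolding abs_mult by (rule mult_right_mono[OF elim(3)]) simp
          ultimately show ?case by (simp add: mult.assoc abs_le_iff)
        qed
      qed (use elim in simp_all)
    qed
  qed

  have "L2_norm \<Omega> (z t) = 0" if t: "s \<le> t" for t
  proof (rule vanishing_of_energy_inequality[where n = "\<lambda>t. L2_norm \<Omega> (z t)" and \<phi> = "\<lambda>t. L2_norm \<Omega> (F t)",
        OF _ _ _ sc(1) _ _ _ _ alpha_mono(1) L0 t])
    show "ess_bounded (\<lambda>t. L2_norm \<Omega> (F t))" by (rule Linf_time_norm[OF F])
    show F2: "ess_bounded (\<lambda>t. (L2_norm \<Omega> (F t))\<^sup>2)"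
      unfolding L2_norm_square by (rule Linf_time_inner[OF F F])
    show "L2_norm \<Omega> (z s) = 0"
      using eq_s L2_norm_eq_0_iff[OF zL2[OF sc(1)]] by (simp add: z_def)
    show "L2_norm \<Omega> (z q) \<le> L2_norm \<Omega> (z p) + (LINT t|lebesgue_on {p..q}. L2_norm \<Omega> (F t))"
      if "s \<le> p" "p \<le> q" for p q
    proof -
      have pq: "0 \<le> p" "0 \<le> q" using that sc by auto
      have "L2_norm \<Omega> (\<lambda>x. z q x - z p x) \<le> (LINT t|lebesgue_on {p..q}. L2_norm \<Omega> (F t))"
        by (intro L2_norm_increment_le F FTC L2_diff zL2 pq that)
      then show ?thesis using L2_norm_diff_triangle[OF zL2[OF pq(2)] zL2[OF pq(1)]] by simp
    qed
    show "\<sigma> * (LINT t|lebesgue_on {p..q}. (L2_norm \<Omega> (F t))\<^sup>2) \<le> L * M * (LINT t|lebesgue_on {p..q}. L2_norm \<Omega> (F t))"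
      if pq: "s \<le> p" "p < q" and zp: "L2_norm \<Omega> (z p) = 0"
        and M: "\<And>t. t \<in> {p..q} \<Longrightarrow> L2_norm \<Omega> (z t) \<le> M" for p q M
    proof -
      have p: "0 \<le> p" using pq sc by simp
      have i: "integrable (lebesgue_on {p..q}) (\<lambda>t. (L2_norm \<Omega> (F t))\<^sup>2)"
        "integrable (lebesgue_on {p..q}) (\<lambda>t. L2_norm \<Omega> (F t))"
        by (intro ess_bounded_integrable F2 Linf_time_norm F p)+
      have "0 \<le> (LINT t|lebesgue_on {p..q}. L2_inner \<Omega> (b t) (F t))"
      proof (rule integral_energy_derivative_nonneg[OF b F z bL2 zL2 FTC _ _ zp p pq(2)])
        show "2 * L2_inner \<Omega> (b q) (z p) \<le> L2_inner \<Omega> (b q) (z q) + L2_inner \<Omega> (b p) (z p)"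
          if "0 \<le> p" "0 \<le> q" for p q
          unfolding b_def[abs_def] z_def[abs_def] using that by (intro L2_inner_B_op_psd(1) uB vB)
        show "0 \<le> L2_inner \<Omega> (b t) (z t)" if "0 \<le> t" for t
          unfolding b_def[abs_def] z_def[abs_def]
          by (rule L2_inner_B_op_psd(2)[OF uB[OF that] vB[OF that] uB[OF that] vB[OF that]])
      qed
      also have "\<dots> \<le> (LINT t|lebesgue_on {p..q}. - \<sigma> * (L2_norm \<Omega> (F t))\<^sup>2 + L * M * L2_norm \<Omega> (F t))"
      proof (rule integral_mono_AE)
        show "integrable (lebesgue_on {p..q}) (\<lambda>t. L2_inner \<Omega> (b t) (F t))"
          by (intro ess_bounded_integrable Linf_time_inner b F p)
        show "integrable (lebesgue_on {p..q}) (\<lambda>t. - \<sigma> * (L2_norm \<Omega> (F t))\<^sup>2 + L * M * L2_norm \<Omega> (F t))"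
          by (intro Bochner_Integration.integrable_add integrable_mult_right i)
        show "AE t in lebesgue_on {p..q}. L2_inner \<Omega> (b t) (F t)
            \<le> - \<sigma> * (L2_norm \<Omega> (F t))\<^sup>2 + L * M * L2_norm \<Omega> (F t)"
          using AE_lebesgue_on_Icc[OF coercive p] AE_space
        proof eventually_elim
          case (elim t)
          then have "t \<in> {p..q}" by simp
          then have "L * (L2_norm \<Omega> (z t) * L2_norm \<Omega> (F t)) \<le> L * (M * L2_norm \<Omega> (F t))"
            by (intro mult_left_mono mult_right_mono M L0 L2_norm_nonneg)
          then show ?case using elim pq by (simp add: mult.assoc)
        qed
      qed
      also have "\<dots> = - \<sigma> * (LINT t|lebesgue_on {p..q}. (L2_norm \<Omega> (F t))\<^sup>2) + L * M * (LINT t|lebesgue_on {p..q}. L2_norm \<Omega> (F t))"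
        using i by simp
      finally show ?thesis by simp
    qed
  qed (simp_all add: L2_norm_nonneg)
  then show ?thesis
    using L2_norm_eq_0_iff[OF zL2] sc(1) by (simp add: z_def)
qed

end
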